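(* Let $\Bbbk=\mathbb{R}$ or $\mathbb{C}$, let $\pi\subset\{1,\ldots,m\}$ and $\pi^c=\{1,\ldots,m\}\setminus\pi$, and let $A\in\mathcal{U}_\pi\subset\Bbbk^{m\times n}$. Then $$\kappa[\mathcal{L}_\pi^{\Bbbk}](A)=\kappa[\mathcal{L}_{\pi^c}^{\Bbbk}](A).$$ That is, the condition number of the orthogonal complement $\mathrm{U}_\pi^\perp$ of a selected left singular subspace $\mathrm{U}_\pi$ is the same as the condition number of $\mathrm{U}_\pi$ itself.
   Context: Condition number: for a map $f:X\to Y$ between metric spaces $(X,d_X)$, $(Y,d_Y)$ and $x\in X$, $$\kappa[f](x):=\lim_{\epsilon\to0}\ \sup_{x'\in X,\ 0<d_X(x,x')\le\epsilon}\frac{d_Y(f(x),f(x'))}{d_X(x,x')}.$$ Singular subspaces: a full SVD of $A\in\Bbbk^{m\times n}$ of rank $r$ is $A=U\widehat\Sigma V^H$ with $U\in\Bbbk^{m\times m}$, $V\in\Bbbk^{n\times n}$ unitary (orthogonal if $\Bbbk=\mathbb{R}$) and $\widehat\Sigma$ the $m\times n$ matrix whose upper left $r\times r$ block is $\mathrm{diag}(\sigma_1,\ldots,\sigma_r)$, $\sigma_1\ge\cdots\ge\sigma_r>0$, and which is zero elsewhere. For a nonzero singular value $\sigma'$ of $A$, $\mathrm{U}_{\sigma'}\subset\Bbbk^m$ is the span of the columns of $U$ corresponding to $\sigma'$, i.e., the eigenspace of $AA^H$ with eigenvalue $\sigma'^2$; $\mathrm{U}_0$ is the cokernel of $A$ (the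 kernel of $AA^H$). A left singular subspace of $A$ is a direct sum of the spaces $\mathrm{U}_{\sigma'}$ over a subset of the set consisting of the distinct nonzero singular values and $0$. For $\pi\subset\{1,\ldots,m\}$ with $\sharp\pi=k$, let $\mathrm{U}_\pi$ be the span of the columns $\mathbf{u}_i$, $i\in\pi$, of $U$ in a full SVD of $A$, and let $\mathcal{U}_\pi=\{A\in\Bbbk^{m\times n}\mid \mathrm{U}_\pi\text{ is a left singular subspace of }A\}$; that is, with $\sigma_{r+1}=\cdots=\sigma_m=0$, whenever $i\in\pi$, all indices $j\in\{1,\ldots,m\}$ with $\sigma_j=\sigma_i$ also lie in $\pi$. On $\mathcal{U}_\pi$ the space $\mathrm{U}_\pi$ is well defined, and $\mathcal{L}_\pi^{\Bbbk}:\mathcal{U}_\pi\to\mathrm{Gr}(k,\Bbbk^m)$, $A\mapsto\mathrm{U}_\pi$. Distances: the domain carries the Frobenius distance $\|A-A'\|_F$. $\mathrm{Gr}(d,\Bbbk^p)$ is the Grassmannian of $d$-dimensional linear subspaces of $\Bbbk^p$, identified with the rank-$d$ orthogonal projectors $QQ^H$, $Q\in\Bbbk^{p\times d}$, $Q^HQ=I_d$. The principal angles between $P=QQ^H$ and $P'=Q'Q'^H$ are $\theta_i=\cos^{-1}(\sigma_i(Q^HQ'))$, $i=1,\ldots,d$; $\boldsymbol\theta=(\theta_1,\ldots,\theta_d)$. The Grassmannians carry any of the chordal distance $\|\sin\boldsymbol\theta\|=\frac1{\sqrt2}\|P-P'\|_F$, the Grassmann distance $\|\boldsymbol\theta\|$,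 or the Procrustes distance $\|2\sin(\boldsymbol\theta/2)\|$ (functions applied elementwise), the same choice on both sides. *)

theory Defs
  imports
    "HOL-Analysis.Analysis"
    "Jordan_Normal_Form.Schur_Decomposition"
begin

text \<open>
  Matrices are those of \<^theory>\<open>Jordan_Normal_Form.Matrix\<close>, so rows, columns and singular values
  are numbered from 0. Everything is generic in the scalars; only the real and the complex numbers
  are of interest, and both come with their usual conjugation and norm.
\<close>

definition unitary_mat :: "nat \<Rightarrow> 'a::conjugatable_field mat \<Rightarrow> bool" where
  "unitary_mat n U \<longleftrightarrow> U \<in> carrier_mat n n \<and> mat_adjoint U * U = 1\<^sub>m n \<and> U * mat_adjoint U = 1\<^sub>m n"

text \<open>
  The singular values are a sequence extended by zeros: with \<open>r\<close> the number of positive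
  ones (necessarily the rank of \<open>A\<close>), \<open>\<sigma> i = 0\<close> for all \<open>i \<ge> r\<close>.
\<close>

definition full_svd ::
  "'a::{conjugatable_field,real_normed_field} mat \<Rightarrow> 'a mat \<Rightarrow> (nat \<Rightarrow> real) \<Rightarrow> 'a mat \<Rightarrow> bool" where
  "full_svd A U \<sigma> V \<longleftrightarrow>
     unitary_mat (dim_row A) U \<and> unitary_mat (dim_col A) V \<and>
     (\<exists>r. r \<le> dim_row A \<and> r \<le> dim_col A \<and>
        (\<forall>i j. i \<le> j \<and> j < r \<longrightarrow> \<sigma> j \<le> \<sigma> i) \<and> (\<forall>i<r. 0 < \<sigma> i) \<and> (\<forall>i\<ge>r. \<sigma> i = 0)) \<and>
     A = U * mat (dim_row A) (dim_col A) (\<lambda>(i, j). if i = j then of_real (\<sigma> i) else 0) * mat_adjoint V"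

definition sing_val :: "'a::{conjugatable_field,real_normed_field} mat \<Rightarrow> nat \<Rightarrow> real" where
  "sing_val A = (THE \<sigma>. \<exists>U V. full_svd A U \<sigma> V)"

text \<open>The eigenspace of \<open>A A\<^sup>H\<close> for the eigenvalue \<open>s\<^sup>2\<close>; the cokernel of \<open>A\<close> if \<open>s = 0\<close>.\<close>

definition left_sing_space ::
  "'a::{conjugatable_field,real_normed_field} mat \<Rightarrow> real \<Rightarrow> 'a vec set" where
  "left_sing_space A s =
     {x \<in> carrier_vec (dim_row A). (A * mat_adjoint A) *\<^sub>v x = of_real (s\<^sup>2) \<cdot>\<^sub>v x}"

text \<open>
  The sum of the spaces below is automatically direct, since eigenspaces of \<open>A A\<^sup>H\<close> for distinct
  eigenvalues are independent.
\<close>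

definition left_singular_subspace ::
  "'a::{conjugatable_field,real_normed_field} mat \<Rightarrow> 'a vec set \<Rightarrow> bool" where
  "left_singular_subspace A W \<longleftrightarrow>
     (\<exists>S. S \<subseteq> insert 0 {sing_val A i | i. sing_val A i \<noteq> 0} \<and>
        W = LinearCombinations.module.span class_ring (module_vec TYPE('a) (dim_row A))
              (\<Union>s\<in>S. left_sing_space A s))"

definition col_span :: "'a::field mat \<Rightarrow> nat set \<Rightarrow> 'a vec set" where
  "col_span U I =
     LinearCombinations.module.span class_ring (module_vec TYPE('a) (dim_row U)) (col U ` I)"

definition left_dom ::
  "nat \<Rightarrow> nat \<Rightarrow> nat set \<Rightarrow> 'a::{conjugatable_field,real_normed_field} mat set" where
  "left_dom m n I =
     {A \<in> carrier_mat m n. \<exists>U \<sigma> V. full_svd A U \<sigma> V \<and> left_singular_subspace A (col_span U I)}"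

text \<open>On \<^const>\<open>left_dom\<close> the described space does not depend on the decomposition.\<close>

definition left_map :: "nat set \<Rightarrow> 'a::{conjugatable_field,real_normed_field} mat \<Rightarrow> 'a vec set" where
  "left_map I A = (THE W. \<exists>U \<sigma> V. full_svd A U \<sigma> V \<and> W = col_span U I)"

definition orth_compl :: "nat \<Rightarrow> 'a::conjugatable_field vec set \<Rightarrow> 'a vec set" where
  "orth_compl p W = {x \<in> carrier_vec p. \<forall>w\<in>W. x \<bullet>c w = 0}"

definition frob_dist :: "'a::real_normed_field mat \<Rightarrow> 'a mat \<Rightarrow> real" where
  "frob_dist A B = sqrt (\<Sum>i<dim_row A. \<Sum>j<dim_col A. (norm (A $$ (i, j) - B $$ (i, j)))\<^sup>2)"

text \<open>
  A point of the Grassmannian of \<open>d\<close>-dimensional subspaces of \<open>p\<close>-space is the subspace \<open>W\<close>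
  itself; the corresponding projector is \<open>Q Q\<^sup>H\<close> for any \<open>Q\<close> with \<open>orthonormal_basis_mat p d W Q\<close>,
  and the principal angles do not depend on the choice of \<open>Q\<close>.
\<close>

definition orthonormal_basis_mat ::
  "nat \<Rightarrow> nat \<Rightarrow> 'a::conjugatable_field vec set \<Rightarrow> 'a mat \<Rightarrow> bool" where
  "orthonormal_basis_mat p d W Q \<longleftrightarrow>
     Q \<in> carrier_mat p d \<and> mat_adjoint Q * Q = 1\<^sub>m d \<and> col_span Q {..<d} = W"

definition principal_angle ::
  "nat \<Rightarrow> nat \<Rightarrow> 'a::{conjugatable_field,real_normed_field} vec set \<Rightarrow> 'a vec set \<Rightarrow> nat \<Rightarrow> real" where
  "principal_angle p d W W' i =
     arccos (sing_val (mat_adjoint (SOME Q. orthonormal_basis_mat p d W Q) *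
                       (SOME Q. orthonormal_basis_mat p d W' Q)) i)"

text \<open>
  With \<open>P\<close>, \<open>P'\<close> the projectors onto the two subspaces, the chordal distance, i.e. the norm of the
  sines, is the Frobenius distance of \<open>P\<close> and \<open>P'\<close> divided by \<open>sqrt 2\<close>.
\<close>

datatype gr_metric = Chordal | Grassmann | Procrustes

fun angle_fun :: "gr_metric \<Rightarrow> real \<Rightarrow> real" where
  "angle_fun Chordal t = sin t"
| "angle_fun Grassmann t = t"
| "angle_fun Procrustes t = 2 * sin (t / 2)"

definition gr_dist ::
  "gr_metric \<Rightarrow> nat \<Rightarrow> nat \<Rightarrow> 'a::{conjugatable_field,real_normed_field} vec set \<Rightarrow> 'a vec set \<Rightarrow> real" where
  "gr_dist \<delta> p d W W' = sqrt (\<Sum>i<d. (angle_fun \<delta> (principal_angle p d W W' i))\<^sup>2)"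

text \<open>Values in the extended nonnegative reals: the limit always exists by monotonicity, and may be infinite.\<close>

definition cond_number ::
  "'x set \<Rightarrow> ('x \<Rightarrow> 'x \<Rightarrow> real) \<Rightarrow> ('y \<Rightarrow> 'y \<Rightarrow> real) \<Rightarrow> ('x \<Rightarrow> 'y) \<Rightarrow> 'x \<Rightarrow> ennreal" where
  "cond_number X dX dY f x =
     Lim (at_right (0::real))
       (\<lambda>\<epsilon>. SUP x'\<in>{x'\<in>X. 0 < dX x x' \<and> dX x x' \<le> \<epsilon>}. ennreal (dY (f x) (f x') / dX x x'))"

definition left_cond ::
  "gr_metric \<Rightarrow> nat \<Rightarrow> nat \<Rightarrow> nat set \<Rightarrow> 'a::{conjugatable_field,real_normed_field} mat \<Rightarrow> ennreal" where
  "left_cond \<delta> m n I A =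
     cond_number (left_dom m n I) frob_dist (gr_dist \<delta> m (card I)) (left_map I) A"

end

theory Submission
  imports Defs
begin

text \<open>
  Taking orthogonal complements is an isometry between Grassmannians, for each of the three distances,
  and the map to \<open>U\<^sub>\<pi>\<^sup>\<bottom>\<close> is the map to \<open>U\<^sub>\<pi>\<close> followed by it. Hence the difference quotients in the
  two condition numbers are equal one by one.

  The isometry rests on principal angles. Let \<open>Q\<close>, \<open>Q'\<close> be orthonormal bases of two subspaces of the
  same dimension and \<open>R\<close>, \<open>R'\<close> of their complements. Since \<open>R' R'\<^sup>H = 1 - Q' Q'\<^sup>H\<close>, the matrix
  \<open>N = Q\<^sup>H R'\<close> satisfies \<open>N N\<^sup>H = 1 - (Q\<^sup>H Q') (Q\<^sup>H Q')\<^sup>H\<close>, whose eigenvalues are the squared sines of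
  the angles between the subspaces. In the same way, the eigenvalues of \<open>N\<^sup>H N\<close> are the squared sines of
  the angles between the complements. But \<open>N N\<^sup>H\<close> and \<open>N\<^sup>H N\<close> have the same nonzero eigenvalues with
  multiplicity (\<open>char_poly_mult_swap\<close>), so the nonzero angles agree (\<open>complementary_squared_sines\<close>), and zero
  angles contribute nothing to any of the distances (\<open>gr_dist_complement\<close>).

  For the angles to be meaningful, square matrices must have singular value decompositions
  (\<open>square_full_svd_exists\<close>) with unique singular values (\<open>full_svd_unique\<close>). That the subspace belonging
  to \<open>\<pi>\<close> is well defined, and that \<open>\<pi>\<close> and its complement give the same domain, follows from a
  description of left singular subspaces: in the columns of \<open>U\<close> they are the spans over index sets that
  are unions of level sets of \<open>\<sigma>\<close> (\<open>left_singular_subspace_col_span_iff\<close>).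
\<close>

no_notation inner (infix "\<bullet>" 70)
no_notation vec_nth (infixl "$" 90)
hide_const (open) Finite_Cartesian_Product.mat Finite_Cartesian_Product.vec Finite_Cartesian_Product.row

section \<open>Adjoint matrices\<close>

lemma dim_mat_adjoint [simp]:
  "dim_row (mat_adjoint A) = dim_col A" "dim_col (mat_adjoint A) = dim_row A"
  by (simp_all add: mat_adjoint_def)

lemma mat_adjoint_carrier [simp, intro]: "A \<in> carrier_mat m n \<Longrightarrow> mat_adjoint A \<in> carrier_mat n m"
  by auto

lemma index_mat_adjoint [simp]:
  "i < dim_col A \<Longrightarrow> j < dim_row A \<Longrightarrow> mat_adjoint A $$ (i, j) = conjugate (A $$ (j, i))"
  by (simp add: mat_adjoint_def mat_of_rows_def)

lemma mat_adjoint_adjoint [simp]: "mat_adjoint (mat_adjoint A) = A"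
  by (rule eq_matI) auto

lemma conjugate_one [simp]: "conjugate (1::'a::conjugatable_field) = 1"
proof -
  have "conjugate (1::'a) * conjugate 1 = conjugate 1"
    by (metis conjugate_dist_mul mult_1)
  then show ?thesis by simp
qed

lemma mat_adjoint_one [simp]: "mat_adjoint (1\<^sub>m n) = 1\<^sub>m n"
  by (rule eq_matI) auto

text \<open>
  The side conditions mention no dimension that is absent from the equation, so the simplifier can
  discharge them; the carrier version leaves the inner dimensions undetermined.
\<close>

lemma mult_mat_assoc_dim:
  assumes "dim_col A = dim_row B" "dim_col B = dim_row C"
  shows "A * B * C = A * (B * C)"
  using assms by (intro assoc_mult_mat) auto

lemma mult_mat_vec_assoc_dim:
  assumes "dim_col A = dim_row B" "dim_col B = dim_vec v"
  shows "(A * B) *\<^sub>v v = A *\<^sub>v (B *\<^sub>v v)"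
  using assms by (intro assoc_mult_mat_vec) auto

lemma mat_adjoint_mult:
  assumes A: "A \<in> carrier_mat m n" and B: "B \<in> carrier_mat n k"
  shows "mat_adjoint (A * B) = mat_adjoint B * mat_adjoint A"
  by (rule eq_matI, insert A B)
     (auto simp: scalar_prod_def sum_conjugate conjugate_dist_mul mult.commute intro!: sum.cong)

lemma index_adjoint_mult:
  assumes A: "A \<in> carrier_mat n a" and B: "B \<in> carrier_mat n b" and ij: "i < a" "j < b"
  shows "(mat_adjoint A * B) $$ (i, j) = col B j \<bullet>c col A i"
  using assms by (auto simp: scalar_prod_def mult.commute intro!: sum.cong)

lemma index_adjoint_mult_vec:
  assumes A: "A \<in> carrier_mat n a" and x: "x \<in> carrier_vec n" and i: "i < a"
  shows "(mat_adjoint A *\<^sub>v x) $ i = x \<bullet>c col A i"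
  using assms by (auto simp: scalar_prod_def mult.commute intro!: sum.cong)

lemma mult_mat_vec_cscalar:
  assumes A: "A \<in> carrier_mat m n" and x: "x \<in> carrier_vec n" and y: "y \<in> carrier_vec m"
  shows "(A *\<^sub>v x) \<bullet>c y = x \<bullet>c (mat_adjoint A *\<^sub>v y)"
proof -
  have "(A *\<^sub>v x) \<bullet>c y = (\<Sum>i<m. \<Sum>j<n. A $$ (i, j) * x $ j * conjugate (y $ i))"
    using assms by (auto simp: scalar_prod_def sum_distrib_right lessThan_atLeast0 intro!: sum.cong)
  also have "\<dots> = (\<Sum>j<n. \<Sum>i<m. A $$ (i, j) * x $ j * conjugate (y $ i))"
    by (rule sum.swap)
  also have "\<dots> = x \<bullet>c (mat_adjoint A *\<^sub>v y)"
    using assms by (auto simp: scalar_prod_def sum_distrib_left sum_conjugate conjugate_dist_mul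
        lessThan_atLeast0 mult_ac intro!: sum.cong)
  finally show ?thesis .
qed

section \<open>Unitary matrices\<close>

lemma unitary_matD:
  assumes "unitary_mat n U"
  shows "U \<in> carrier_mat n n" "mat_adjoint U * U = 1\<^sub>m n" "U * mat_adjoint U = 1\<^sub>m n"
    "mat_adjoint U \<in> carrier_mat n n"
  using assms by (auto simp: unitary_mat_def)

lemma unitary_matI:
  assumes "U \<in> carrier_mat n n" "mat_adjoint U * U = 1\<^sub>m n"
  shows "unitary_mat n U"
  using assms mat_mult_left_right_inverse[of "mat_adjoint U" n U] by (auto simp: unitary_mat_def)

lemma unitary_cols:
  fixes U :: "'a::conjugatable_field mat"
  assumes U: "unitary_mat n U" and ij: "i < n" "j < n"
  shows "col U j \<bullet>c col U i = (if i = j then 1 else 0)"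
  using index_adjoint_mult[OF unitary_matD(1)[OF U] unitary_matD(1)[OF U] ij] unitary_matD(2)[OF U] ij
  by simp

lemma unitary_mat_one [simp]: "unitary_mat n (1\<^sub>m n)"
  by (auto simp: unitary_mat_def)

lemma unitary_mat_mult:
  assumes U: "unitary_mat n U" and V: "unitary_mat n V"
  shows "unitary_mat n (U * V)"
proof (rule unitary_matI)
  note c = unitary_matD[OF U] unitary_matD[OF V]
  show "U * V \<in> carrier_mat n n" using c by auto
  have "mat_adjoint (U * V) * (U * V) = mat_adjoint V * (mat_adjoint U * U) * V"
    using c(1,4,5,8) by (simp add: mat_adjoint_mult[of _ n n _ n] mult_mat_assoc_dim)
  then show "mat_adjoint (U * V) * (U * V) = 1\<^sub>m n"
    using c by simp
qed

text \<open>
  A pair of adjacent factors \<open>U\<^sup>H U\<close> or \<open>U U\<^sup>H\<close> drops out of a product; the bracketing is the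
  one in which products of decompositions \<open>U S V\<^sup>H\<close> arise.
\<close>

lemma unitary_cancel:
  assumes "unitary_mat n U" "X \<in> carrier_mat m n" "Y \<in> carrier_mat n k"
  shows "X * mat_adjoint U * (U * Y) = X * Y" "X * U * (mat_adjoint U * Y) = X * Y"
proof -
  note c = unitary_matD[OF assms(1)]
  have "X * mat_adjoint U * (U * Y) = X * (mat_adjoint U * U) * Y"
    using c(1,4) assms(2,3) by (simp add: mult_mat_assoc_dim)
  then show "X * mat_adjoint U * (U * Y) = X * Y" using c assms by simp
  have "X * U * (mat_adjoint U * Y) = X * (U * mat_adjoint U) * Y"
    using c(1,4) assms(2,3) by (simp add: mult_mat_assoc_dim)
  then show "X * U * (mat_adjoint U * Y) = X * Y" using c assms by simp
qed

lemma char_poly_unitary_similar: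
  assumes "unitary_mat n U" "D \<in> carrier_mat n n"
  shows "char_poly (U * D * mat_adjoint U) = char_poly D"
  using unitary_matD[OF assms(1)] assms(2)
  by (intro char_poly_similar similar_matI[of _ _ U "mat_adjoint U" n]) auto

section \<open>Real and complex scalars\<close>

text \<open>
  The two scalar fields are treated at once. Everything below needs two facts about them:
  \<open>x\<close> times its conjugate is \<open>\<bar>x\<bar>\<^sup>2\<close>, and a nonempty Hermitian matrix has a real eigenvalue with an eigenvector
  over the same field. Both follow from an isometric embedding into the complex numbers that respects
  conjugation, so this embedding is the class parameter.
\<close>

class real_or_complex_field = conjugatable_ordered_field + real_normed_field +
  fixes to_complex :: "'a \<Rightarrow> complex"
  assumes to_complex_add: "to_complex (x + y) = to_complex x + to_complex y"
    and to_complex_mult: "to_complex (x * y) = to_complex x * to_complex y"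
    and to_complex_one: "to_complex 1 = 1"
    and to_complex_scaleR: "to_complex (r *\<^sub>R x) = r *\<^sub>R to_complex x"
    and to_complex_conjugate: "to_complex (conjugate x) = cnj (to_complex x)"
    and norm_to_complex: "cmod (to_complex x) = norm x"

instantiation real :: real_or_complex_field
begin
definition "to_complex = complex_of_real"
instance by standard (simp_all add: to_complex_real_def scaleR_conv_of_real)
end

instantiation complex :: real_or_complex_field
begin
definition "to_complex = (\<lambda>z::complex. z)"
instance by standard (simp_all add: to_complex_complex_def)
end

lemma field_hom_to_complex: "field_hom (to_complex :: 'a::real_or_complex_field \<Rightarrow> complex)"
proof
  show "to_complex (0::'a) = 0"
    using norm_to_complex[of "0::'a"] by simp
qed (auto simp: to_complex_add to_complex_mult to_complex_one)

lemma to_complex_of_real: "to_complex (of_real r :: 'a::real_or_complex_field) = of_real r"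
  by (simp add: of_real_def to_complex_scaleR to_complex_one)

lemma inj_to_complex: "inj (to_complex :: 'a::real_or_complex_field \<Rightarrow> complex)"
proof -
  interpret field_hom "to_complex :: 'a \<Rightarrow> complex" by (rule field_hom_to_complex)
  show ?thesis by (rule injI) simp
qed

lemma mult_conjugate_eq_norm:
  "x * conjugate x = of_real ((norm x)\<^sup>2)" for x :: "'a::real_or_complex_field"
proof -
  have "to_complex (x * conjugate x) = of_real ((norm x)\<^sup>2)"
    unfolding to_complex_mult to_complex_conjugate complex_norm_square[symmetric] norm_to_complex ..
  then show ?thesis
    using inj_to_complex[THEN injD] by (metis to_complex_of_real)
qed

lemma conjugate_of_real [simp]: "conjugate (of_real r :: 'a::real_or_complex_field) = of_real r"
  by (rule inj_to_complex[THEN injD]) (simp add: to_complex_conjugate to_complex_of_real)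

definition sq_norm_vec :: "'a::real_normed_vector vec \<Rightarrow> real" where
  "sq_norm_vec v = (\<Sum>i<dim_vec v. (norm (v $ i))\<^sup>2)"

lemma cscalar_self: "v \<bullet>c v = of_real (sq_norm_vec v)" for v :: "'a::real_or_complex_field vec"
  by (simp add: scalar_prod_def sq_norm_vec_def mult_conjugate_eq_norm lessThan_atLeast0)

lemma sq_norm_vec_nonneg: "0 \<le> sq_norm_vec v"
  by (simp add: sq_norm_vec_def sum_nonneg)

lemma sq_norm_vec_pos:
  fixes v :: "'a::real_or_complex_field vec"
  assumes "v \<in> carrier_vec n" "v \<noteq> 0\<^sub>v n"
  shows "0 < sq_norm_vec v"
  using sq_norm_vec_nonneg[of v] cscalar_self[of v] conjugate_square_eq_0_vec[OF assms(1)] assms(2)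
  by (metis less_eq_real_def of_real_0)

lemma cscalar_smult:
  fixes v w :: "'a::conjugatable_field vec"
  assumes "v \<in> carrier_vec n" "w \<in> carrier_vec n"
  shows "(a \<cdot>\<^sub>v v) \<bullet>c w = a * (v \<bullet>c w)" "v \<bullet>c (a \<cdot>\<^sub>v w) = conjugate a * (v \<bullet>c w)"
  using assms by (auto simp: conjugate_smult_vec)

section \<open>Hermitian eigenvalues and orthonormal completion\<close>

text \<open>
  Over the complex numbers the characteristic polynomial has a root, and it is real because
  \<open>\<langle>Cv, v\<rangle> = \<langle>v, Cv\<rangle>\<close>. The characteristic polynomial of the embedded matrix is the image of that of
  \<open>B\<close>, so the real root is already a root over the original field, and it has an eigenvector there.
\<close>

lemma hermitian_real_eigenvalue:
  fixes B :: "'a::real_or_complex_field mat"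
  assumes B: "B \<in> carrier_mat n n" and n: "0 < n" and herm: "mat_adjoint B = B"
  shows "\<exists>l::real. eigenvalue B (of_real l)"
proof -
  interpret h: field_hom "to_complex :: 'a \<Rightarrow> complex" by (rule field_hom_to_complex)
  define C where "C = map_mat to_complex B"
  have C: "C \<in> carrier_mat n n" using B by (simp add: C_def)
  have "mat_adjoint C = map_mat to_complex (mat_adjoint B)"
    using B by (intro eq_matI) (auto simp: C_def to_complex_conjugate)
  then have hermC: "mat_adjoint C = C" by (simp add: herm C_def)
  have "\<not> constant (poly (char_poly C))"
    using degree_monic_char_poly[OF C] n by (simp add: constant_degree)
  then obtain z where z: "poly (char_poly C) z = 0"
    using fundamental_theorem_of_algebra by blast
  then obtain v where v: "v \<in> carrier_vec n" "v \<noteq> 0\<^sub>v n" "C *\<^sub>v v = z \<cdot>\<^sub>v v"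
    using eigenvalue_root_char_poly[OF C] C by (auto simp: eigenvalue_def eigenvector_def)
  have "z * (v \<bullet>c v) = cnj z * (v \<bullet>c v)"
    using mult_mat_vec_cscalar[OF C v(1) v(1)] v by (simp add: hermC cscalar_smult[of _ n])
  moreover have "v \<bullet>c v \<noteq> 0" using v by simp
  ultimately have "z = cnj z" by simp
  then have zR: "z = of_real (Re z)" by (simp add: complex_eq_iff)
  have "to_complex (poly (char_poly B) (of_real (Re z))) = 0"
    using z unfolding C_def h.char_poly_hom[OF B]
    by (subst (asm) zR) (metis to_complex_of_real h.poly_map_poly)
  then have "poly (char_poly B) (of_real (Re z)) = 0" by simp
  then show ?thesis using eigenvalue_root_char_poly[OF B] by blast
qed

lemma finite_real_eigenvalues:
  fixes B :: "'a::real_or_complex_field mat"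
  assumes B: "B \<in> carrier_mat n n"
  shows "finite {l::real. eigenvalue B (of_real l)}"
proof -
  have "char_poly B \<noteq> 0" using degree_monic_char_poly[OF B] by auto
  then have "finite {x. poly (char_poly B) x = 0}" by (rule poly_roots_finite)
  then have "finite ((of_real :: real \<Rightarrow> 'a) -` {x. poly (char_poly B) x = 0})"
    by (rule finite_vimageI) (simp add: inj_of_real)
  then show ?thesis by (simp add: eigenvalue_root_char_poly[OF B] vimage_def)
qed

text \<open>
  Gram-Schmidt, applied to a basis that starts with \<open>u\<close>, keeps \<open>u\<close> in front; the remaining vectors
  only have to be normalised.
\<close>

lemma unitary_completion:
  fixes u :: "'a::real_or_complex_field vec"
  assumes u: "u \<in> carrier_vec n" and unit: "sq_norm_vec u = 1"
  shows "\<exists>U. unitary_mat n U \<and> col U 0 = u"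
proof -
  interpret cof_vec_space n "TYPE('a)" .
  have u0: "u \<noteq> 0\<^sub>v n" using unit by (auto simp: sq_norm_vec_def)
  then have n: "0 < n" using u by (cases n) auto
  define ws where "ws = gram_schmidt n (basis_completion u)"
  note b = basis_completion[OF u u0]
  have ws: "corthogonal ws" "set ws \<subseteq> carrier_vec n" "length ws = n"
    using gram_schmidt_result[OF b(2,4,5) ws_def] b(6) by auto
  have "ws ! 0 = u"
    using gram_schmidt_hd[OF u, of "tl (basis_completion u)"] b(6,7) n ws(3)
    by (metis hd_Cons_tl hd_conv_nth length_0_conv less_numeral_extra(3) ws_def)
  have wsc: "ws ! i \<in> carrier_vec n" if "i < n" for i using ws that by auto
  have orth: "ws ! i \<bullet>c ws ! j = 0 \<longleftrightarrow> i \<noteq> j" if "i < n" "j < n" for i j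
    using corthogonalD[OF ws(1)] ws(3) that by simp
  define c where "c i = 1 / sqrt (sq_norm_vec (ws ! i))" for i
  define U where "U = mat_of_cols n (map (\<lambda>i. of_real (c i) \<cdot>\<^sub>v ws ! i) [0..<n])"
  have U: "U \<in> carrier_mat n n" unfolding U_def by (intro carrier_matI) auto
  have colU: "col U i = of_real (c i) \<cdot>\<^sub>v ws ! i" if "i < n" for i
    unfolding U_def using that wsc by (subst col_mat_of_cols) auto
  have "mat_adjoint U * U = 1\<^sub>m n"
  proof (rule eq_matI)
    fix i j assume "i < dim_row (1\<^sub>m n)" "j < dim_col (1\<^sub>m n)"
    then have ij: "i < n" "j < n" by auto
    have "(mat_adjoint U * U) $$ (i, j) = of_real (c i * c j) * (ws ! j \<bullet>c ws ! i)"
      using ij wsc by (simp add: index_adjoint_mult[OF U U] colU cscalar_smult[of _ n])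
    also have "\<dots> = (if i = j then 1 else 0)"
    proof (cases "i = j")
      case True
      have "sq_norm_vec (ws ! i) > 0"
        using orth[OF ij(1) ij(1)] sq_norm_vec_nonneg[of "ws ! i"] cscalar_self[of "ws ! i"]
        by (metis less_eq_real_def of_real_0)
      then have "c i * c i * sq_norm_vec (ws ! i) = 1"
        by (simp add: c_def)
      then show ?thesis using True by (simp add: cscalar_self flip: of_real_mult)
    qed (use ij orth in auto)
    finally show "(mat_adjoint U * U) $$ (i, j) = 1\<^sub>m n $$ (i, j)" using ij by simp
  qed (use U in auto)
  then have "unitary_mat n U" using U by (rule unitary_matI[rotated])
  moreover have "col U 0 = u"
    using colU[OF n] \<open>ws ! 0 = u\<close> unit by (simp add: c_def)
  ultimately show ?thesis by blast
qed

section \<open>Rectangular diagonal matrices and singular values\<close>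

definition rect_diag :: "nat \<Rightarrow> nat \<Rightarrow> (nat \<Rightarrow> 'a::zero) \<Rightarrow> 'a mat" where
  "rect_diag m n d = mat m n (\<lambda>(i, j). if i = j then d i else 0)"

lemma rect_diag_carrier [simp]: "rect_diag m n d \<in> carrier_mat m n"
  by (simp add: rect_diag_def)

lemma dim_rect_diag [simp]: "dim_row (rect_diag m n d) = m" "dim_col (rect_diag m n d) = n"
  by (simp_all add: rect_diag_def)

lemma mat_adjoint_rect_diag:
  "mat_adjoint (rect_diag m n (\<lambda>i. of_real (f i) :: 'a::real_or_complex_field)) =
     rect_diag n m (\<lambda>i. of_real (f i))"
  by (rule eq_matI) (auto simp: rect_diag_def)

lemma rect_diag_mult:
  fixes d e :: "nat \<Rightarrow> 'a::semiring_0"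
  assumes "\<And>i. n \<le> i \<Longrightarrow> d i * e i = 0"
  shows "rect_diag m n d * rect_diag n k e = rect_diag m k (\<lambda>i. d i * e i)"
proof (rule eq_matI)
  fix i j assume "i < dim_row (rect_diag m k (\<lambda>i. d i * e i))"
    "j < dim_col (rect_diag m k (\<lambda>i. d i * e i))"
  then have ij: "i < m" "j < k" by auto
  have "(rect_diag m n d * rect_diag n k e) $$ (i, j) =
      (\<Sum>l\<in>{0..<n}. (if i = l then d i else 0) * (if l = j then e l else 0))"
    using ij by (simp add: rect_diag_def scalar_prod_def)
  also have "\<dots> = (\<Sum>l\<in>{0..<n}. if l = i then (if i = j then d i * e i else 0) else 0)"
    by (rule sum.cong) auto
  also have "\<dots> = rect_diag m k (\<lambda>i. d i * e i) $$ (i, j)"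
    using ij assms[of i] by (auto simp: rect_diag_def)
  finally show "(rect_diag m n d * rect_diag n k e) $$ (i, j) =
      rect_diag m k (\<lambda>i. d i * e i) $$ (i, j)" .
qed auto

lemma char_poly_rect_diag:
  "char_poly (rect_diag m m d) = (\<Prod>i<m. [:- d i, 1:])" for d :: "nat \<Rightarrow> 'a::field"
proof -
  have "char_poly (rect_diag m m d) = (\<Prod>a\<leftarrow>diag_mat (rect_diag m m d). [:- a, 1:])"
    by (rule char_poly_upper_triangular[of _ m]) (auto simp: upper_triangular_def rect_diag_def)
  also have "diag_mat (rect_diag m m d) = map d [0..<m]"
    by (auto simp: diag_mat_def rect_diag_def)
  finally show ?thesis
    by (simp add: prod.distinct_set_conv_list[symmetric] comp_def lessThan_atLeast0)
qed

lemma char_poly_unitary_diag: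
  "unitary_mat m U \<Longrightarrow> char_poly (U * rect_diag m m d * mat_adjoint U) = (\<Prod>i<m. [:- d i, 1:])"
  by (simp add: char_poly_unitary_similar char_poly_rect_diag)

text \<open>
  Multisets of roots turn equalities of characteristic polynomials into equalities of eigenvalues
  counted with multiplicity, which is how singular values are compared throughout.
\<close>

lemma proots_prod_linear:
  "proots (\<Prod>i<m. [:- d i, 1:]) = image_mset d (mset_set {..<m})" for d :: "nat \<Rightarrow> 'a::field"
  by (induction m) (simp_all add: lessThan_Suc proots_mult del: mult_pCons_left)

text \<open>
  The number of positive singular values can be forgotten: a decreasing sequence that vanishes from
  \<open>min m n\<close> on is nonnegative, and its positive part is an initial segment.
\<close>

lemma full_svd_iff:
  fixes A :: "'a::real_or_complex_field mat"
  assumes A: "A \<in> carrier_mat m n"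
  shows "full_svd A U \<sigma> V \<longleftrightarrow> unitary_mat m U \<and> unitary_mat n V \<and> antimono \<sigma> \<and>
     (\<forall>i\<ge>min m n. \<sigma> i = 0) \<and> A = U * rect_diag m n (\<lambda>i. of_real (\<sigma> i)) * mat_adjoint V"
proof -
  have "(\<exists>r. r \<le> m \<and> r \<le> n \<and> (\<forall>i j. i \<le> j \<and> j < r \<longrightarrow> \<sigma> j \<le> \<sigma> i) \<and>
      (\<forall>i<r. 0 < \<sigma> i) \<and> (\<forall>i\<ge>r. \<sigma> i = 0)) \<longleftrightarrow> antimono \<sigma> \<and> (\<forall>i\<ge>min m n. \<sigma> i = 0)"
    (is "?L \<longleftrightarrow> ?R")
  proof
    assume ?L
    then obtain r where r: "r \<le> m" "r \<le> n" "\<And>i j. i \<le> j \<Longrightarrow> j < r \<Longrightarrow> \<sigma> j \<le> \<sigma> i"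
      "\<And>i. i < r \<Longrightarrow> 0 < \<sigma> i" "\<And>i. i \<ge> r \<Longrightarrow> \<sigma> i = 0" by auto
    have "\<sigma> j \<le> \<sigma> i" if "i \<le> j" for i j
      using r(3)[of i j] r(4)[of i] r(5)[of i] r(5)[of j] that
      by (metis le_less_linear less_eq_real_def)
    then show ?R using r by (auto intro: antimonoI)
  next
    assume R: ?R
    define r where "r = (LEAST i. \<sigma> i = 0)"
    have z: "\<sigma> (min m n) = 0" using R by auto
    have r: "r \<le> min m n" "\<sigma> r = 0"
      unfolding r_def using z by (rule Least_le, rule LeastI)
    have nonneg: "0 \<le> \<sigma> i" for i
      using R antimonoD[of \<sigma> i "max i (min m n)"] by auto
    have "\<sigma> i \<noteq> 0" if "i < r" for i using that not_less_Least unfolding r_def by blast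
    moreover have "\<sigma> i = 0" if "i \<ge> r" for i
      using R r(2) antimonoD[of \<sigma> r i] that nonneg[of i] by auto
    ultimately show ?L using R r nonneg
      by (intro exI[of _ r]) (auto simp: antimono_def less_le)
  qed
  then show ?thesis using A by (auto simp: full_svd_def rect_diag_def)
qed

lemma full_svdD:
  fixes A :: "'a::real_or_complex_field mat"
  assumes "full_svd A U \<sigma> V" "A \<in> carrier_mat m n"
  shows "unitary_mat m U" "unitary_mat n V" "antimono \<sigma>" "\<And>i. i \<ge> m \<Longrightarrow> \<sigma> i = 0"
    "\<And>i. i \<ge> n \<Longrightarrow> \<sigma> i = 0" "A = U * rect_diag m n (\<lambda>i. of_real (\<sigma> i)) * mat_adjoint V"
    "\<And>i. 0 \<le> \<sigma> i"
proof -
  show *: "unitary_mat m U" "unitary_mat n V" "antimono \<sigma>" "\<And>i. i \<ge> m \<Longrightarrow> \<sigma> i = 0"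
    "\<And>i. i \<ge> n \<Longrightarrow> \<sigma> i = 0" "A = U * rect_diag m n (\<lambda>i. of_real (\<sigma> i)) * mat_adjoint V"
    using assms full_svd_iff[OF assms(2)] by auto
  show "0 \<le> \<sigma> i" for i
    using *(4)[of "max i m"] antimonoD[OF *(3), of i "max i m"] by auto
qed

lemma full_svd_adjoint:
  fixes A :: "'a::real_or_complex_field mat"
  assumes svd: "full_svd A U \<sigma> V"
  shows "full_svd (mat_adjoint A) V \<sigma> U"
proof -
  define m n where "m = dim_row A" and "n = dim_col A"
  have A: "A \<in> carrier_mat m n" by (simp add: m_def n_def)
  note d = full_svdD[OF svd A]
  note c = unitary_matD[OF d(1)] unitary_matD[OF d(2)]
  define S :: "'a mat" where "S = rect_diag m n (\<lambda>i. of_real (\<sigma> i))"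
  have S: "S \<in> carrier_mat m n" by (simp add: S_def)
  have "mat_adjoint A = mat_adjoint (U * S * mat_adjoint V)"
    using d(6) by (simp add: S_def)
  also have "\<dots> = V * mat_adjoint S * mat_adjoint U"
    using c(1,4,5,8) S by (simp add: mat_adjoint_mult[of _ m n _ n] mat_adjoint_mult[of _ m m _ n] mult_mat_assoc_dim)
  finally have "mat_adjoint A = V * rect_diag n m (\<lambda>i. of_real (\<sigma> i)) * mat_adjoint U"
    by (simp add: S_def mat_adjoint_rect_diag)
  then show ?thesis
    using d full_svd_iff[OF mat_adjoint_carrier[OF A], of V \<sigma> U] by (auto simp: min_def)
qed

lemma full_svd_gram:
  fixes A :: "'a::real_or_complex_field mat"
  assumes svd: "full_svd A U \<sigma> V" and A: "A \<in> carrier_mat m n"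
  shows "A * mat_adjoint A = U * rect_diag m m (\<lambda>i. of_real ((\<sigma> i)\<^sup>2)) * mat_adjoint U"
proof -
  note d = full_svdD[OF svd A]
  note c = unitary_matD[OF d(1)] unitary_matD[OF d(2)]
  define S S' :: "'a mat" where "S = rect_diag m n (\<lambda>i. of_real (\<sigma> i))"
    and "S' = rect_diag n m (\<lambda>i. of_real (\<sigma> i))"
  have S: "S \<in> carrier_mat m n" "S' \<in> carrier_mat n m" by (simp_all add: S_def S'_def)
  have eq: "A = U * S * mat_adjoint V" "mat_adjoint A = V * S' * mat_adjoint U"
    using d(6) full_svdD(6)[OF full_svd_adjoint[OF svd], of n m] A by (simp_all add: S_def S'_def)
  have "A * mat_adjoint A = U * S * mat_adjoint V * (V * (S' * mat_adjoint U))"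
    unfolding eq(2) using c(5,4) S eq(1) by (simp add: eq(1) mult_mat_assoc_dim)
  also have "\<dots> = U * S * (S' * mat_adjoint U)"
    using c S by (intro unitary_cancel(1)[OF d(2), of _ m _ m]) auto
  also have "\<dots> = U * (S * S') * mat_adjoint U"
    using c(1,4) S by (simp add: mult_mat_assoc_dim)
  also have "S * S' = rect_diag m m (\<lambda>i. of_real ((\<sigma> i)\<^sup>2))"
    unfolding S_def S'_def using d(5) by (subst rect_diag_mult) (auto simp: power2_eq_square)
  finally show ?thesis .
qed

lemma char_poly_gram:
  fixes A :: "'a::real_or_complex_field mat"
  assumes svd: "full_svd A U \<sigma> V" and A: "A \<in> carrier_mat m n"
  shows "char_poly (A * mat_adjoint A) = (\<Prod>i<m. [:- of_real ((\<sigma> i)\<^sup>2), 1:])"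
  unfolding full_svd_gram[OF assms] using full_svdD(1)[OF assms] by (rule char_poly_unitary_diag)

text \<open>
  For a matrix of inner products between two orthonormal bases, the eigenvalues \<open>1 - \<sigma>\<^sub>i\<^sup>2\<close> found here
  are the squared sines of the principal angles.
\<close>

lemma char_poly_one_minus_gram:
  fixes A :: "'a::real_or_complex_field mat"
  assumes svd: "full_svd A U \<sigma> V" and A: "A \<in> carrier_mat m n"
  shows "char_poly (1\<^sub>m m - A * mat_adjoint A) = (\<Prod>i<m. [:- of_real (1 - (\<sigma> i)\<^sup>2), 1:])"
proof -
  note c = unitary_matD[OF full_svdD(1)[OF assms]]
  define D D' :: "'a mat" where "D = rect_diag m m (\<lambda>i. of_real ((\<sigma> i)\<^sup>2))"
    and "D' = rect_diag m m (\<lambda>i. of_real (1 - (\<sigma> i)\<^sup>2))"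
  have D: "D \<in> carrier_mat m m" by (simp add: D_def)
  have D': "D' = 1\<^sub>m m - D"
    by (rule eq_matI) (auto simp: D_def D'_def rect_diag_def)
  have "U * D' * mat_adjoint U = U * mat_adjoint U - U * D * mat_adjoint U"
    unfolding D' using c D by (simp add: mult_minus_distrib_mat[of _ m m _ m] minus_mult_distrib_mat[of _ m m _ _ m])
  also have "\<dots> = 1\<^sub>m m - A * mat_adjoint A"
    using c(3) full_svd_gram[OF assms] by (simp add: D_def)
  finally show ?thesis
    using char_poly_unitary_diag[OF full_svdD(1)[OF assms], of "\<lambda>i. of_real (1 - (\<sigma> i)\<^sup>2)"]
    by (simp only: D'_def)
qed

text \<open>
  The characteristic polynomial of \<open>A A\<^sup>H\<close> determines the multiset of the squares, hence of the
  nonnegative values \<open>\<sigma>\<^sub>i\<close>, and a decreasing list is determined by its multiset.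
\<close>

lemma full_svd_unique:
  fixes A :: "'a::real_or_complex_field mat"
  assumes 1: "full_svd A U \<sigma> V" and 2: "full_svd A U' \<tau> V'"
  shows "\<sigma> = \<tau>"
proof -
  define m n where "m = dim_row A" and "n = dim_col A"
  have A: "A \<in> carrier_mat m n" by (simp add: m_def n_def)
  note d = full_svdD[OF 1 A] full_svdD[OF 2 A]
  have eq: "image_mset (\<lambda>i. of_real ((\<sigma> i)\<^sup>2) :: 'a) (mset_set {..<m}) =
      image_mset (\<lambda>i. of_real ((\<tau> i)\<^sup>2)) (mset_set {..<m})"
    using char_poly_gram[OF 1 A] char_poly_gram[OF 2 A]
    by (metis proots_prod_linear)
  have n: "sqrt (norm (of_real (x\<^sup>2) :: 'a)) = x" if "0 \<le> x" for x
    using that by (simp add: norm_power)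
  have "image_mset \<sigma> (mset_set {..<m}) = image_mset \<tau> (mset_set {..<m})"
    using arg_cong[OF eq, of "image_mset (\<lambda>z. sqrt (norm z))"] d(7,14)
    by (simp only: multiset.map_comp comp_def n)
  then have "mset (rev (map \<sigma> [0..<m])) = mset (rev (map \<tau> [0..<m]))"
    by (simp add: lessThan_atLeast0)
  moreover have "sorted (rev (map \<sigma> [0..<m]))" "sorted (rev (map \<tau> [0..<m]))"
    using d(3,10) by (auto simp: sorted_rev_iff_nth_mono antimono_def)
  ultimately have "rev (map \<sigma> [0..<m]) = rev (map \<tau> [0..<m])"
    by (metis properties_for_sort)
  then have "\<sigma> i = \<tau> i" if "i < m" for i using that by (auto simp: map_eq_conv)
  then show ?thesis using d(4,11) by (metis le_less_linear ext)
qed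

lemma sing_val_eqI:
  fixes A :: "'a::real_or_complex_field mat"
  assumes "full_svd A U \<sigma> V"
  shows "sing_val A = \<sigma>"
  unfolding sing_val_def using assms full_svd_unique by blast

section \<open>Existence of singular value decompositions\<close>

text \<open>
  The block diagonal matrix with blocks \<open>c\<close> and \<open>A\<close>: the shape that remains when one singular value
  has been split off.
\<close>

definition bordered :: "'a::zero \<Rightarrow> 'a mat \<Rightarrow> 'a mat" where
  "bordered c A = four_block_mat (mat 1 1 (\<lambda>_. c)) (0\<^sub>m 1 (dim_col A)) (0\<^sub>m (dim_row A) 1) A"

lemma bordered_carrier [simp]: "A \<in> carrier_mat m n \<Longrightarrow> bordered c A \<in> carrier_mat (Suc m) (Suc n)"
  unfolding bordered_def by (auto intro!: carrier_matI)

lemma bordered_eq_mat: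
  assumes "A \<in> carrier_mat m n"
  shows "bordered c A = mat (Suc m) (Suc n) (\<lambda>(i, j).
    case i of 0 \<Rightarrow> (case j of 0 \<Rightarrow> c | Suc _ \<Rightarrow> 0) | Suc i' \<Rightarrow> (case j of 0 \<Rightarrow> 0 | Suc j' \<Rightarrow> A $$ (i', j')))"
  using assms unfolding bordered_def by (intro eq_matI) (auto split: nat.splits)

lemma bordered_mult:
  fixes A B :: "'a::semiring_0 mat"
  assumes "A \<in> carrier_mat m n" "B \<in> carrier_mat n k"
  shows "bordered a A * bordered b B = bordered (a * b) (A * B)"
proof -
  have 1: "mat 1 1 (\<lambda>_. a) * mat 1 1 (\<lambda>_. b) = mat 1 1 (\<lambda>_. a * b)"
    by (rule eq_matI) (auto simp: scalar_prod_def)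
  show ?thesis
    unfolding bordered_def using assms
    by (subst mult_four_block_mat[of _ 1 1 _ n _ m _ _ 1 _ k]) (auto simp: 1 simp del: One_nat_def)
qed

lemma mat_adjoint_bordered:
  "mat_adjoint (bordered c A) = bordered (conjugate c) (mat_adjoint A)"
  unfolding bordered_def by (intro eq_matI) auto

lemma bordered_one: "bordered 1 (1\<^sub>m n) = 1\<^sub>m (Suc n)"
  unfolding bordered_def by (intro eq_matI) auto

lemma bordered_rect_diag: "bordered c (rect_diag m n d) = rect_diag (Suc m) (Suc n) (case_nat c d)"
  unfolding bordered_eq_mat[OF rect_diag_carrier]
  by (intro eq_matI) (auto simp: rect_diag_def split: nat.splits)

lemma unitary_bordered:
  assumes "unitary_mat n U"
  shows "unitary_mat (Suc n) (bordered 1 U)"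
  using unitary_matD[OF assms]
  by (intro unitary_matI) (auto simp: mat_adjoint_bordered bordered_mult[of _ n n _ n] bordered_one)

lemma char_poly_bordered:
  fixes A :: "'a::field mat"
  assumes "A \<in> carrier_mat n n"
  shows "char_poly (bordered c A) = [:- c, 1:] * char_poly A"
proof -
  have "char_poly (mat 1 1 (\<lambda>_. c)) = [:- c, 1:]"
    by (simp add: char_poly_defs det_def sign_def)
  then show ?thesis
    using char_poly_four_block_zeros_col[of "mat 1 1 (\<lambda>_. c)" "0\<^sub>m 1 n" n A] assms
    by (simp add: bordered_def)
qed

lemma exists_unit_multiple:
  fixes v :: "'a::real_or_complex_field vec"
  assumes "v \<in> carrier_vec n" "v \<noteq> 0\<^sub>v n"
  shows "\<exists>c. sq_norm_vec (c \<cdot>\<^sub>v v) = 1"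
proof
  have "sq_norm_vec (of_real (1 / sqrt (sq_norm_vec v)) \<cdot>\<^sub>v v) =
      (1 / sqrt (sq_norm_vec v))\<^sup>2 * sq_norm_vec v"
    by (simp add: sq_norm_vec_def norm_mult power_mult_distrib sum_distrib_left norm_divide power_divide)
  also have "\<dots> = 1"
    using sq_norm_vec_pos[OF assms] by (simp add: power_divide)
  finally show "sq_norm_vec (of_real (1 / sqrt (sq_norm_vec v)) \<cdot>\<^sub>v v) = 1" .
qed

text \<open>
  Take \<open>s\<^sup>2\<close> to be the largest eigenvalue of \<open>A A\<^sup>H\<close> and \<open>u\<close> a unit eigenvector. If \<open>s > 0\<close>, then
  \<open>v = A\<^sup>H u / s\<close> is the partner of \<open>u\<close>. That \<open>s\<^sup>2\<close> is largest is kept because it makes the singular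
  values come out in decreasing order.
\<close>

lemma top_singular_pair:
  fixes A :: "'a::real_or_complex_field mat"
  assumes A: "A \<in> carrier_mat n n" and n: "0 < n"
  obtains s u v where "0 \<le> s" "u \<in> carrier_vec n" "v \<in> carrier_vec n"
    "sq_norm_vec u = 1" "sq_norm_vec v = 1"
    "A *\<^sub>v v = of_real s \<cdot>\<^sub>v u" "mat_adjoint A *\<^sub>v u = of_real s \<cdot>\<^sub>v v"
    "\<And>l. eigenvalue (A * mat_adjoint A) (of_real l) \<Longrightarrow> l \<le> s\<^sup>2"
proof -
  define B where "B = A * mat_adjoint A"
  have Ah: "mat_adjoint A \<in> carrier_mat n n" using A by auto
  have B: "B \<in> carrier_mat n n" using A Ah by (simp add: B_def)
  have herm: "mat_adjoint B = B"
    unfolding B_def using A Ah by (simp add: mat_adjoint_mult[of _ n n _ n])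
  define R where "R = {l::real. eigenvalue B (of_real l)}"
  have R: "finite R" "R \<noteq> {}"
    using finite_real_eigenvalues[OF B] hermitian_real_eigenvalue[OF B n herm] by (auto simp: R_def)
  define L where "L = Max R"
  have "L \<in> R" using R by (simp add: L_def)
  then obtain w where w: "w \<in> carrier_vec n" "w \<noteq> 0\<^sub>v n" "B *\<^sub>v w = of_real L \<cdot>\<^sub>v w"
    using B by (auto simp: R_def eigenvalue_def eigenvector_def)
  obtain c where c: "sq_norm_vec (c \<cdot>\<^sub>v w) = 1" using exists_unit_multiple[OF w(1,2)] ..
  define u where "u = c \<cdot>\<^sub>v w"
  have u: "u \<in> carrier_vec n" "sq_norm_vec u = 1" using w(1) c by (simp_all add: u_def)
  have Bu: "B *\<^sub>v u = of_real L \<cdot>\<^sub>v u"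
    using w B by (simp add: u_def mult_mat_vec[of _ n n] smult_smult_assoc mult.commute)
  define z where "z = mat_adjoint A *\<^sub>v u"
  have z: "z \<in> carrier_vec n" unfolding z_def using Ah u(1) by (rule mult_mat_vec_carrier)
  have Az: "A *\<^sub>v z = of_real L \<cdot>\<^sub>v u"
    using Bu A Ah u by (simp add: B_def z_def assoc_mult_mat_vec[of _ n n _ n])
  have "(of_real (sq_norm_vec z) :: 'a) = z \<bullet>c z" by (simp add: cscalar_self)
  also have "\<dots> = u \<bullet>c (A *\<^sub>v z)"
    using mult_mat_vec_cscalar[OF Ah u(1) z] by (simp add: z_def)
  also have "\<dots> = of_real L"
    using u by (simp add: Az cscalar_smult[of _ n] cscalar_self)
  finally have zL: "sq_norm_vec z = L" by simp
  then have L0: "0 \<le> L" using sq_norm_vec_nonneg[of z] by simp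
  have max: "l \<le> (sqrt L)\<^sup>2" if "eigenvalue (A * mat_adjoint A) (of_real l)" for l
    using that R L0 by (simp add: L_def R_def B_def)
  show ?thesis
  proof (cases "L = 0")
    case False
    then have Lp: "0 < L" using L0 by simp
    define v where "v = of_real (1 / sqrt L) \<cdot>\<^sub>v z"
    have v: "v \<in> carrier_vec n" using z by (simp add: v_def)
    have "sq_norm_vec v = (1 / sqrt L)\<^sup>2 * sq_norm_vec z"
      by (simp add: v_def sq_norm_vec_def norm_mult power_mult_distrib sum_distrib_left norm_divide power_divide)
    then have v1: "sq_norm_vec v = 1" using Lp zL by (simp add: power_divide)
    have "A *\<^sub>v v = of_real (1 / sqrt L * L) \<cdot>\<^sub>v u"
      using A z by (simp add: v_def mult_mat_vec[of _ n n] Az smult_smult_assoc)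
    also have "1 / sqrt L * L = sqrt L" using Lp by (simp add: real_div_sqrt)
    finally have Av: "A *\<^sub>v v = of_real (sqrt L) \<cdot>\<^sub>v u" .
    have "of_real (sqrt L) \<cdot>\<^sub>v v = z"
      using Lp by (simp add: v_def smult_smult_assoc flip: of_real_mult)
    then show ?thesis
      using that[OF _ u(1) v u(2) v1 Av _ max] Lp by (simp add: z_def)
  next
    case True
    \<comment> \<open>here the top singular value is 0 and \<open>A\<close> is singular, so the second vector comes from its kernel\<close>
    have "z = 0\<^sub>v n"
      using zL True sq_norm_vec_pos[OF z] by auto
    have "u \<noteq> 0\<^sub>v n" using u by (auto simp: sq_norm_vec_def)
    have "mat_adjoint A *\<^sub>v u = 0\<^sub>v n" using \<open>z = 0\<^sub>v n\<close> by (simp add: z_def)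
    have zero_smult: "0 \<cdot>\<^sub>v y = 0\<^sub>v n" if "y \<in> carrier_vec n" for y :: "'a vec"
      using that by auto
    then have "det B = 0"
      using det_0_iff_vec_prod_zero[OF B] u \<open>u \<noteq> 0\<^sub>v n\<close> Bu True by auto
    then have "det (mat_adjoint A * A) = 0"
      using A Ah by (auto simp: B_def det_mult[of _ n])
    then obtain x where x: "x \<in> carrier_vec n" "x \<noteq> 0\<^sub>v n" "mat_adjoint A *\<^sub>v (A *\<^sub>v x) = 0\<^sub>v n"
      using det_0_iff_vec_prod_zero[OF mult_carrier_mat[OF Ah A]]
      by (auto simp: assoc_mult_mat_vec[OF Ah A])
    have Ax: "A *\<^sub>v x \<in> carrier_vec n" using A x(1) by (rule mult_mat_vec_carrier)
    have "(A *\<^sub>v x) \<bullet>c (A *\<^sub>v x) = 0"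
      using mult_mat_vec_cscalar[OF A x(1) Ax] x by simp
    then have "A *\<^sub>v x = 0\<^sub>v n" using Ax by simp
    obtain c where c: "sq_norm_vec (c \<cdot>\<^sub>v x) = 1" using exists_unit_multiple[OF x(1,2)] ..
    have "c \<cdot>\<^sub>v 0\<^sub>v n = 0\<^sub>v n" by auto
    then have "A *\<^sub>v (c \<cdot>\<^sub>v x) = 0\<^sub>v n"
      using A x(1) \<open>A *\<^sub>v x = 0\<^sub>v n\<close> by (simp add: mult_mat_vec[of _ n n])
    then show ?thesis
      using that[of "sqrt L" u "c \<cdot>\<^sub>v x"] c u x(1) max True \<open>mat_adjoint A *\<^sub>v u = 0\<^sub>v n\<close>
      by (simp add: zero_smult)
  qed
qed

text \<open>
  Deflation: in orthonormal bases starting with the top pair \<open>u\<close>, \<open>v\<close> the matrix \<open>A\<close> becomes block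
  diagonal with blocks \<open>s\<close> and \<open>A'\<close>, and \<open>A'\<close> is decomposed by induction. Its singular values are at
  most \<open>s\<close>, since their squares are eigenvalues of \<open>A A\<^sup>H\<close> too. Square matrices suffice, because the
  principal angles are read off from square matrices.
\<close>

lemma square_full_svd_exists:
  fixes A :: "'a::real_or_complex_field mat"
  assumes "A \<in> carrier_mat n n"
  shows "\<exists>U \<sigma> V. full_svd A U \<sigma> V"
  using assms
proof (induction n arbitrary: A)
  case 0
  then have "full_svd A (1\<^sub>m 0) (\<lambda>_. 0) (1\<^sub>m 0)"
    by (subst full_svd_iff[of _ 0 0]) (auto simp: antimono_def)
  then show ?case by blast
next
  case (Suc n)
  note A = Suc.prems
  have Ah: "mat_adjoint A \<in> carrier_mat (Suc n) (Suc n)" using A by auto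
  obtain s u v where suv: "0 \<le> s" "u \<in> carrier_vec (Suc n)" "v \<in> carrier_vec (Suc n)"
    "sq_norm_vec u = 1" "sq_norm_vec v = 1"
    "A *\<^sub>v v = of_real s \<cdot>\<^sub>v u" "mat_adjoint A *\<^sub>v u = of_real s \<cdot>\<^sub>v v"
    and max: "\<And>l. eigenvalue (A * mat_adjoint A) (of_real l) \<Longrightarrow> l \<le> s\<^sup>2"
    using top_singular_pair[OF A] by blast
  obtain U where U: "unitary_mat (Suc n) U" "col U 0 = u" using unitary_completion[OF suv(2,4)] by blast
  obtain V where V: "unitary_mat (Suc n) V" "col V 0 = v" using unitary_completion[OF suv(3,5)] by blast
  note c = unitary_matD[OF U(1)] unitary_matD[OF V(1)]
  define M where "M = mat_adjoint U * (A * V)"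
  have M: "M \<in> carrier_mat (Suc n) (Suc n)" using c A by (auto simp: M_def)
  have Mij: "M $$ (i, j) = (A *\<^sub>v col V j) \<bullet>c col U i" if "i < Suc n" "j < Suc n" for i j
    unfolding M_def index_adjoint_mult[OF c(1) mult_carrier_mat[OF A c(5)] that]
      col_mult2[OF A c(5) that(2)] ..
  have Mi0: "M $$ (i, 0) = (if i = 0 then of_real s else 0)" if "i < Suc n" for i
    using that suv c(1) unitary_cols[OF U(1), of i 0]
    by (simp add: Mij V(2) U(2) cscalar_smult[of _ "Suc n"])
  have M0j: "M $$ (0, j) = (if j = 0 then of_real s else 0)" if "j < Suc n" for j
  proof -
    have "M $$ (0, j) = col V j \<bullet>c (mat_adjoint A *\<^sub>v u)"
      using that c(5) suv(2) by (simp add: Mij U(2) mult_mat_vec_cscalar[OF A])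
    then show ?thesis
      using that suv c(5) unitary_cols[OF V(1), of 0 j]
      by (simp add: V(2) cscalar_smult[of _ "Suc n"])
  qed
  define A' where "A' = mat n n (\<lambda>(i, j). M $$ (Suc i, Suc j))"
  have A': "A' \<in> carrier_mat n n" by (simp add: A'_def)
  have MA': "M = bordered (of_real s) A'"
    unfolding bordered_eq_mat[OF A']
    by (rule eq_matI) (use M Mi0 M0j in \<open>auto simp: A'_def split: nat.splits\<close>)
  have "U * M * mat_adjoint V = (U * mat_adjoint U) * (A * (V * mat_adjoint V))"
    unfolding M_def using c(1,4,5,8) A by (simp add: mult_mat_assoc_dim)
  then have AM: "A = U * M * mat_adjoint V" using c A by simp
  obtain U' \<sigma> V' where svd: "full_svd A' U' \<sigma> V'" using Suc.IH[OF A'] by blast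
  note d = full_svdD[OF svd A']
  have "A * mat_adjoint A = U * (M * mat_adjoint M) * mat_adjoint U"
  proof -
    have "mat_adjoint A = V * (mat_adjoint M * mat_adjoint U)"
      unfolding AM using c(1,4,5,8) M
      by (simp add: mat_adjoint_mult[of _ "Suc n" "Suc n" _ "Suc n"] mult_mat_assoc_dim)
    then have "A * mat_adjoint A = U * M * mat_adjoint V * (V * (mat_adjoint M * mat_adjoint U))"
      using AM by simp
    also have "\<dots> = U * M * (mat_adjoint M * mat_adjoint U)"
      using c M by (intro unitary_cancel(1)[OF V(1), of _ "Suc n" _ "Suc n"]) auto
    finally show ?thesis using c(1,4) M by (simp add: mult_mat_assoc_dim)
  qed
  then have "char_poly (A * mat_adjoint A) = char_poly (M * mat_adjoint M)"
    using M by (simp add: char_poly_unitary_similar[OF U(1)])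
  also have "M * mat_adjoint M = bordered (of_real (s\<^sup>2)) (A' * mat_adjoint A')"
    unfolding MA' mat_adjoint_bordered using A'
    by (simp add: bordered_mult[of _ n n _ n] power2_eq_square)
  also have "char_poly \<dots> = [:- of_real (s\<^sup>2), 1:] * (\<Prod>i<n. [:- of_real ((\<sigma> i)\<^sup>2), 1:])"
    using A' by (simp add: char_poly_bordered[of _ n] char_poly_gram[OF svd A'])
  finally have cp: "char_poly (A * mat_adjoint A) =
      [:- of_real (s\<^sup>2), 1:] * (\<Prod>i<n. [:- of_real ((\<sigma> i)\<^sup>2), 1:])" .
  have "\<sigma> i \<le> s" for i
  proof (cases "i < n")
    case True
    have "poly (char_poly (A * mat_adjoint A)) (of_real ((\<sigma> i)\<^sup>2)) = 0"
      unfolding cp using True by (auto simp: poly_prod)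
    then have "eigenvalue (A * mat_adjoint A) (of_real ((\<sigma> i)\<^sup>2))"
      using A Ah by (subst eigenvalue_root_char_poly[of _ "Suc n"]) auto
    then have "(\<sigma> i)\<^sup>2 \<le> s\<^sup>2" by (rule max)
    then show ?thesis using suv(1) by (rule power2_le_imp_le)
  qed (use d suv in auto)
  then have mono: "antimono (case_nat s \<sigma>)"
    using d(3) by (auto simp: antimono_def split: nat.splits)
  define S S' :: "'a mat" where "S = rect_diag n n (\<lambda>i. of_real (\<sigma> i))"
    and "S' = rect_diag (Suc n) (Suc n) (\<lambda>i. of_real (case_nat s \<sigma> i))"
  have S: "S \<in> carrier_mat n n" "S' \<in> carrier_mat (Suc n) (Suc n)" by (simp_all add: S_def S'_def)
  have "(\<lambda>i. of_real (case_nat s \<sigma> i) :: 'a) = case_nat (of_real s) (\<lambda>i. of_real (\<sigma> i))"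
    by (auto split: nat.splits)
  then have S': "S' = bordered (of_real s) S"
    by (simp only: S_def S'_def bordered_rect_diag)
  define X Y where "X = bordered 1 U'" and "Y = bordered 1 V'"
  have XY: "unitary_mat (Suc n) X" "unitary_mat (Suc n) Y"
    using d unitary_bordered by (auto simp: X_def Y_def)
  note e = unitary_matD[OF XY(1)] unitary_matD[OF XY(2)]
  have "A' = U' * S * mat_adjoint V'" using d(6) by (simp only: S_def)
  then have "M = X * S' * mat_adjoint Y"
    unfolding MA' S' X_def Y_def mat_adjoint_bordered
    using unitary_matD[OF d(1)] unitary_matD[OF d(2)] S
    by (simp add: bordered_mult[of _ n n _ n] mult_mat_assoc_dim)
  then have "A = U * (X * S' * mat_adjoint Y) * mat_adjoint V" using AM by simp
  also have "\<dots> = (U * X) * S' * mat_adjoint (V * Y)"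
    using c(1,4,5,8) e(1,4,5,8) S
    by (simp add: mat_adjoint_mult[of _ "Suc n" "Suc n" _ "Suc n"] mult_mat_assoc_dim)
  finally have "full_svd A (U * X) (case_nat s \<sigma>) (V * Y)"
    unfolding S'_def using mono d(4) U(1) V(1) XY
    by (subst full_svd_iff[OF A]) (auto simp: unitary_mat_mult split: nat.splits)
  then show ?case by blast
qed

section \<open>Spans of columns of a unitary matrix\<close>

lemma vec_span_least:
  fixes W :: "'a::field vec set"
  assumes "W \<subseteq> carrier_vec n" "0\<^sub>v n \<in> W" "\<And>x y. x \<in> W \<Longrightarrow> y \<in> W \<Longrightarrow> x + y \<in> W"
    "\<And>a x. x \<in> W \<Longrightarrow> a \<cdot>\<^sub>v x \<in> W" "X \<subseteq> W"
  shows "LinearCombinations.module.span class_ring (module_vec TYPE('a) n) X \<subseteq> W"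
proof -
  interpret vec_space "TYPE('a)" n .
  have "submodule class_ring W V"
    using assms(1-4) by (intro submodule.intro[OF module_axioms]) (auto simp: module_vec_def)
  then show ?thesis using assms(5) by (intro span_is_subset) auto
qed

text \<open>
  The set of vectors orthogonal to a given family of columns is a subspace, so it contains the span
  of any of its subsets.
\<close>

lemma span_subset_orthogonal_to_cols:
  fixes U :: "'a::conjugatable_field mat" and J :: "nat set"
  assumes U: "U \<in> carrier_mat m k"
  defines "W \<equiv> {x \<in> carrier_vec m. \<forall>i<k. i \<notin> J \<longrightarrow> x \<bullet>c col U i = 0}"
  assumes "X \<subseteq> W"
  shows "LinearCombinations.module.span class_ring (module_vec TYPE('a) m) X \<subseteq> W"
proof (rule vec_span_least)
  have col: "col U i \<in> carrier_vec m" for i using U by auto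
  show "0\<^sub>v m \<in> W" using col by (auto simp: W_def)
  show "x + y \<in> W" if "x \<in> W" "y \<in> W" for x y
    using that col by (auto simp: W_def add_scalar_prod_distrib[of _ m])
  show "a \<cdot>\<^sub>v x \<in> W" if "x \<in> W" for a x
    using that col by (auto simp: W_def cscalar_smult[of _ m])
qed (use assms in \<open>auto simp: W_def\<close>)

text \<open>
  This description by orthogonality replaces linear combinations in all that follows. A vector
  orthogonal to the other columns lies in the span because \<open>x = U (U\<^sup>H x)\<close> expands it in the columns of
  \<open>U\<close>, and the coefficients outside \<open>J\<close> vanish.
\<close>

lemma col_span_unitary:
  fixes U :: "'a::conjugatable_field mat"
  assumes U: "unitary_mat m U" and J: "J \<subseteq> {..<m}"
  shows "col_span U J = {x \<in> carrier_vec m. \<forall>i<m. i \<notin> J \<longrightarrow> x \<bullet>c col U i = 0}" (is "_ = ?W")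
proof
  interpret vec_space "TYPE('a)" m .
  note c = unitary_matD[OF U]
  have span: "col_span U J = span (col U ` J)" using c by (simp add: col_span_def)
  have cc: "col U i \<in> carrier_vec m" for i using c by auto
  note UU = unitary_cols[OF U]
  show "col_span U J \<subseteq> ?W"
    unfolding span using c(1) J UU cc by (intro span_subset_orthogonal_to_cols) auto
  show "?W \<subseteq> col_span U J"
  proof
    fix x assume x: "x \<in> ?W"
    define y where "y = mat_adjoint U *\<^sub>v x"
    have y: "y \<in> carrier_vec m" unfolding y_def using c(4) x by (intro mult_mat_vec_carrier) auto
    have y0: "y $ i = 0" if "i < m" "i \<notin> J" for i
      using that x by (simp add: y_def index_adjoint_mult_vec[OF c(1)])
    have sub: "vec m (\<lambda>k. \<Sum>i\<in>F. y $ i * U $$ (k, i)) \<in> span (col U ` J)" if "finite F" "F \<subseteq> J" for F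
      using that
    proof (induction F rule: finite_induct)
      case empty
      have "vec m (\<lambda>k. \<Sum>i\<in>{}. y $ i * U $$ (k, i)) = 0\<^sub>v m" by auto
      then show ?case using cc by (auto simp: span_zero)
    next
      case (insert i F)
      then have "i < m" using J by auto
      have "vec m (\<lambda>k. \<Sum>i\<in>insert i F. y $ i * U $$ (k, i)) =
          y $ i \<cdot>\<^sub>v col U i + vec m (\<lambda>k. \<Sum>i\<in>F. y $ i * U $$ (k, i))"
        using insert.hyps c(1) \<open>i < m\<close> by (intro eq_vecI) auto
      moreover have "y $ i \<cdot>\<^sub>v col U i \<in> span (col U ` J)"
        using insert.prems cc by (intro smult_in_span) (auto intro!: in_own_span[THEN subsetD])
      ultimately show ?case
        using insert cc by (auto intro!: span_add1)
    qed
    have "x = (U * mat_adjoint U) *\<^sub>v x" using c(3) x by simp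
    also have "\<dots> = U *\<^sub>v y" using c(1,4) x by (simp add: y_def assoc_mult_mat_vec[of _ m m _ m])
    also have "\<dots> = vec m (\<lambda>k. \<Sum>i\<in>J. y $ i * U $$ (k, i))"
    proof (rule eq_vecI)
      fix k assume "k < dim_vec (vec m (\<lambda>k. \<Sum>i\<in>J. y $ i * U $$ (k, i)))"
      then have k: "k < m" by simp
      have "(U *\<^sub>v y) $ k = (\<Sum>i<m. y $ i * U $$ (k, i))"
        using k c(1) y by (auto simp: scalar_prod_def lessThan_atLeast0 mult.commute intro!: sum.cong)
      also have "\<dots> = (\<Sum>i\<in>J. y $ i * U $$ (k, i))"
        using J y0 by (intro sum.mono_neutral_right) auto
      finally show "(U *\<^sub>v y) $ k = vec m (\<lambda>k. \<Sum>i\<in>J. y $ i * U $$ (k, i)) $ k" using k by simp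
    qed (use c(1) in auto)
    finally show "x \<in> col_span U J"
      unfolding span using sub[of J] J finite_subset[OF J] by simp
  qed
qed

lemma col_in_col_span_iff:
  fixes U :: "'a::real_or_complex_field mat"
  assumes U: "unitary_mat m U" and J: "J \<subseteq> {..<m}" and i: "i < m"
  shows "col U i \<in> col_span U J \<longleftrightarrow> i \<in> J"
  using unitary_matD(1)[OF U] unitary_cols[OF U _ i] i
  by (auto simp: col_span_unitary[OF U J] split: if_splits)

lemma col_span_unitary_inj:
  fixes U :: "'a::real_or_complex_field mat"
  assumes "unitary_mat m U" "I \<subseteq> {..<m}" "J \<subseteq> {..<m}" "col_span U I = col_span U J"
  shows "I = J"
  using col_in_col_span_iff[OF assms(1,2)] col_in_col_span_iff[OF assms(1,3)] assms(2-4) by blast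

lemma col_span_orthogonal:
  fixes U :: "'a::conjugatable_field mat"
  assumes U: "unitary_mat m U" and I: "I \<subseteq> {..<m}"
    and x: "x \<in> col_span U I" and y: "y \<in> col_span U ({..<m} - I)"
  shows "x \<bullet>c y = 0"
proof -
  note c = unitary_matD[OF U]
  have xy: "x \<in> carrier_vec m" "y \<in> carrier_vec m"
    and x0: "\<And>i. i < m \<Longrightarrow> i \<notin> I \<Longrightarrow> x \<bullet>c col U i = 0"
    and y0: "\<And>i. i < m \<Longrightarrow> i \<in> I \<Longrightarrow> y \<bullet>c col U i = 0"
    using x y I by (auto simp: col_span_unitary[OF U])
  define y' where "y' = mat_adjoint U *\<^sub>v y"
  have y': "y' \<in> carrier_vec m" unfolding y'_def using c(4) xy(2) by (rule mult_mat_vec_carrier)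
  have "y = (U * mat_adjoint U) *\<^sub>v y" using c(3) xy by simp
  also have "\<dots> = U *\<^sub>v y'" using c(1,4) xy by (simp add: y'_def assoc_mult_mat_vec[of _ m m _ m])
  finally have "x \<bullet>c y = x \<bullet>c (mat_adjoint (mat_adjoint U) *\<^sub>v y')" by simp
  also have "\<dots> = (mat_adjoint U *\<^sub>v x) \<bullet>c y'"
    using mult_mat_vec_cscalar[OF c(4) xy(1) y'] by simp
  also have "\<dots> = (\<Sum>i<m. (x \<bullet>c col U i) * conjugate (y \<bullet>c col U i))"
    using y' c(4) xy unfolding scalar_prod_def[of "mat_adjoint U *\<^sub>v x"] y'_def
    by (auto simp: index_adjoint_mult_vec[OF c(1)] lessThan_atLeast0 simp del: index_mult_mat_vec intro!: sum.cong)
  also have "\<dots> = 0"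
    using x0 y0 by (intro sum.neutral) (metis conjugate_zero lessThan_iff mult_eq_0_iff)
  finally show ?thesis .
qed

lemma orth_compl_col_span:
  fixes U :: "'a::real_or_complex_field mat"
  assumes U: "unitary_mat m U" and I: "I \<subseteq> {..<m}"
  shows "orth_compl m (col_span U I) = col_span U ({..<m} - I)"
proof (intro equalityI subsetI)
  fix x assume x: "x \<in> orth_compl m (col_span U I)"
  then show "x \<in> col_span U ({..<m} - I)"
    using col_in_col_span_iff[OF U I] I by (auto simp: orth_compl_def col_span_unitary[OF U Diff_subset])
next
  fix x assume x: "x \<in> col_span U ({..<m} - I)"
  have "x \<bullet>c w = 0" if "w \<in> col_span U I" for w
  proof -
    have "{..<m} - ({..<m} - I) = I" using I by auto
    then show ?thesis using col_span_orthogonal[OF U Diff_subset x, of w] that by simp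
  qed
  then show "x \<in> orth_compl m (col_span U I)"
    using x by (auto simp: orth_compl_def col_span_unitary[OF U Diff_subset])
qed

section \<open>Left singular subspaces\<close>

text \<open>
  In the coordinates \<open>y = U\<^sup>H x\<close> the eigenvalue equation of \<open>A A\<^sup>H\<close> reads \<open>\<sigma>\<^sub>i\<^sup>2 y\<^sub>i = s\<^sup>2 y\<^sub>i\<close>, and
  \<open>\<sigma>\<^sub>i\<^sup>2 = s\<^sup>2\<close> only if \<open>\<sigma>\<^sub>i = s\<close>, both being nonnegative.
\<close>

lemma left_sing_space_svd:
  fixes A :: "'a::real_or_complex_field mat"
  assumes svd: "full_svd A U \<sigma> V" and A: "A \<in> carrier_mat m n" and s: "0 \<le> s"
  shows "left_sing_space A s = {x \<in> carrier_vec m. \<forall>i<m. \<sigma> i \<noteq> s \<longrightarrow> x \<bullet>c col U i = 0}"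
proof -
  note d = full_svdD[OF svd A]
  note c = unitary_matD[OF d(1)]
  define D :: "'a mat" where "D = rect_diag m m (\<lambda>i. of_real ((\<sigma> i)\<^sup>2))"
  have D: "D \<in> carrier_mat m m" by (simp add: D_def)
  have "(A * mat_adjoint A) *\<^sub>v x = of_real (s\<^sup>2) \<cdot>\<^sub>v x \<longleftrightarrow>
      (\<forall>i<m. \<sigma> i \<noteq> s \<longrightarrow> x \<bullet>c col U i = 0)" if x: "x \<in> carrier_vec m" for x
  proof -
    define y where "y = mat_adjoint U *\<^sub>v x"
    have y: "y \<in> carrier_vec m" unfolding y_def using c(4) x by (rule mult_mat_vec_carrier)
    have Dy: "D *\<^sub>v y \<in> carrier_vec m" using D y by (rule mult_mat_vec_carrier)
    have cancel: "mat_adjoint U *\<^sub>v (U *\<^sub>v z) = z" "U *\<^sub>v (mat_adjoint U *\<^sub>v z) = z" if "z \<in> carrier_vec m" for z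
      using that c(2,3) assoc_mult_mat_vec[OF c(4,1) that] assoc_mult_mat_vec[OF c(1,4) that] by simp_all
    have "(A * mat_adjoint A) *\<^sub>v x = U *\<^sub>v (D *\<^sub>v y)"
      unfolding full_svd_gram[OF svd A] D_def[symmetric] y_def using c(1,4) D x
      by (simp add: mult_mat_vec_assoc_dim)
    moreover have "of_real (s\<^sup>2) \<cdot>\<^sub>v x = U *\<^sub>v (of_real (s\<^sup>2) \<cdot>\<^sub>v y)"
      using cancel(2)[OF x] y c(1) by (simp add: y_def mult_mat_vec[of _ m m])
    ultimately have "(A * mat_adjoint A) *\<^sub>v x = of_real (s\<^sup>2) \<cdot>\<^sub>v x \<longleftrightarrow>
        U *\<^sub>v (D *\<^sub>v y) = U *\<^sub>v (of_real (s\<^sup>2) \<cdot>\<^sub>v y)"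
      by simp
    also have "\<dots> \<longleftrightarrow> D *\<^sub>v y = of_real (s\<^sup>2) \<cdot>\<^sub>v y"
      using cancel(1)[OF Dy] cancel(1)[OF smult_carrier_vec[THEN iffD2, OF y]] by metis
    also have "\<dots> \<longleftrightarrow> (\<forall>i<m. of_real ((\<sigma> i)\<^sup>2) * y $ i = of_real (s\<^sup>2) * y $ i)"
    proof -
      have "(D *\<^sub>v y) $ i = of_real ((\<sigma> i)\<^sup>2) * y $ i" if "i < m" for i
      proof -
        have "(D *\<^sub>v y) $ i = (\<Sum>j\<in>{0..<m}. (if i = j then of_real ((\<sigma> i)\<^sup>2) else 0) * y $ j)"
          using that y D by (auto simp: D_def rect_diag_def scalar_prod_def intro!: sum.cong)
        also have "\<dots> = (\<Sum>j\<in>{0..<m}. if j = i then of_real ((\<sigma> i)\<^sup>2) * y $ i else 0)"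
          by (rule sum.cong) auto
        finally show ?thesis using that by simp
      qed
      then show ?thesis using Dy y D by (auto simp: vec_eq_iff)
    qed
    also have "\<dots> \<longleftrightarrow> (\<forall>i<m. \<sigma> i \<noteq> s \<longrightarrow> y $ i = 0)"
      using d(7) s by (auto simp: power2_eq_iff_nonneg simp flip: of_real_power)
    also have "\<dots> \<longleftrightarrow> (\<forall>i<m. \<sigma> i \<noteq> s \<longrightarrow> x \<bullet>c col U i = 0)"
      by (simp add: y_def index_adjoint_mult_vec[OF c(1) x] del: index_mult_mat_vec)
    finally show ?thesis .
  qed
  then show ?thesis using A by (auto simp: left_sing_space_def)
qed

lemma span_left_sing_spaces:
  fixes A :: "'a::real_or_complex_field mat"
  assumes svd: "full_svd A U \<sigma> V" and A: "A \<in> carrier_mat m n" and S: "\<And>s. s \<in> S \<Longrightarrow> 0 \<le> s"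
  shows "LinearCombinations.module.span class_ring (module_vec TYPE('a) m) (\<Union>s\<in>S. left_sing_space A s)
     = col_span U {i\<in>{..<m}. \<sigma> i \<in> S}" (is "?L = ?R")
proof
  interpret vec_space "TYPE('a)" m .
  note d = full_svdD[OF svd A]
  note c = unitary_matD[OF d(1)]
  have R: "?R = {x \<in> carrier_vec m. \<forall>i<m. i \<notin> {i\<in>{..<m}. \<sigma> i \<in> S} \<longrightarrow> x \<bullet>c col U i = 0}"
    by (rule col_span_unitary[OF d(1)]) auto
  show "?L \<subseteq> ?R"
    unfolding R
    by (rule span_subset_orthogonal_to_cols[OF c(1)]) (auto simp: left_sing_space_svd[OF svd A S])
  have "col U ` {i\<in>{..<m}. \<sigma> i \<in> S} \<subseteq> (\<Union>s\<in>S. left_sing_space A s)"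
    using c(1) unitary_cols[OF d(1)] by (auto simp: left_sing_space_svd[OF svd A S])
  moreover have "(\<Union>s\<in>S. left_sing_space A s) \<subseteq> carrier_vec m"
    by (auto simp: left_sing_space_svd[OF svd A S])
  ultimately show "?R \<subseteq> ?L"
    unfolding col_span_def using c(1) by (simp add: span_is_monotone)
qed

text \<open>
  Columns of \<open>U\<close> span a left singular subspace exactly if their index set is a preimage under \<open>\<sigma>\<close>,
  a condition that is visibly stable under complements.
\<close>

lemma left_singular_subspace_col_span_iff:
  fixes A :: "'a::real_or_complex_field mat"
  assumes svd: "full_svd A U \<sigma> V" and A: "A \<in> carrier_mat m n" and I: "I \<subseteq> {..<m}"
  shows "left_singular_subspace A (col_span U I) \<longleftrightarrow>
     (\<exists>S. S \<subseteq> insert 0 (range \<sigma>) \<and> I = {i\<in>{..<m}. \<sigma> i \<in> S})"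
proof -
  note d = full_svdD[OF svd A]
  have vals: "insert 0 {sing_val A i | i. sing_val A i \<noteq> 0} = insert 0 (range \<sigma>)"
    by (auto simp: sing_val_eqI[OF svd])
  have "col_span U I = LinearCombinations.module.span class_ring (module_vec TYPE('a) m)
      (\<Union>s\<in>S. left_sing_space A s) \<longleftrightarrow> I = {i\<in>{..<m}. \<sigma> i \<in> S}" if "S \<subseteq> insert 0 (range \<sigma>)" for S
  proof -
    have "0 \<le> s" if "s \<in> S" for s using that \<open>S \<subseteq> _\<close> d(7) by auto
    then have eq: "LinearCombinations.module.span class_ring (module_vec TYPE('a) m)
        (\<Union>s\<in>S. left_sing_space A s) = col_span U {i\<in>{..<m}. \<sigma> i \<in> S}"
      by (rule span_left_sing_spaces[OF svd A])
    show ?thesis unfolding eq using col_span_unitary_inj[OF d(1) I, of "{i\<in>{..<m}. \<sigma> i \<in> S}"] by auto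
  qed
  then show ?thesis
    using A unfolding left_singular_subspace_def vals by auto
qed

text \<open>
  The span is a sum of eigenspaces of \<open>A A\<^sup>H\<close> for a set of singular values, and neither the
  eigenspaces nor the set depends on the decomposition.
\<close>

lemma col_span_independent_of_svd:
  fixes A :: "'a::real_or_complex_field mat"
  assumes svd: "full_svd A U \<sigma> V" and svd': "full_svd A U' \<sigma>' V'"
    and A: "A \<in> carrier_mat m n" and I: "I \<subseteq> {..<m}"
    and sing: "left_singular_subspace A (col_span U I)"
  shows "col_span U' I = col_span U I"
proof -
  have [simp]: "\<sigma>' = \<sigma>" using svd svd' by (metis full_svd_unique)
  obtain S where S: "S \<subseteq> insert 0 (range \<sigma>)" "I = {i\<in>{..<m}. \<sigma> i \<in> S}"
    using sing left_singular_subspace_col_span_iff[OF svd A I] by blast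
  then have nonneg: "\<And>s. s \<in> S \<Longrightarrow> 0 \<le> s" using full_svdD(7)[OF svd A] by auto
  show ?thesis
    using span_left_sing_spaces[OF svd A nonneg] span_left_sing_spaces[OF svd' A nonneg]
    unfolding S(2) by simp
qed

lemma left_map_eq:
  fixes A :: "'a::real_or_complex_field mat"
  assumes "A \<in> left_dom m n I" "I \<subseteq> {..<m}" "full_svd A U \<sigma> V"
  shows "left_map I A = col_span U I"
  unfolding left_map_def
proof (rule the_equality)
  obtain U0 \<sigma>0 V0 where *: "A \<in> carrier_mat m n" "full_svd A U0 \<sigma>0 V0"
    "left_singular_subspace A (col_span U0 I)"
    using assms(1) by (auto simp: left_dom_def)
  then show "W = col_span U I" if "\<exists>U \<sigma> V. full_svd A U \<sigma> V \<and> W = col_span U I" for W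
    using that assms(2,3) col_span_independent_of_svd by metis
qed (use assms in blast)

lemma left_dom_complement_subset:
  assumes I: "I \<subseteq> {..<m}"
  shows "(left_dom m n I :: 'a::real_or_complex_field mat set) \<subseteq> left_dom m n ({..<m} - I)"
proof
  fix A :: "'a mat" assume "A \<in> left_dom m n I"
  then obtain U \<sigma> V where A: "A \<in> carrier_mat m n" and svd: "full_svd A U \<sigma> V"
    and "left_singular_subspace A (col_span U I)"
    by (auto simp: left_dom_def)
  then obtain S where S: "S \<subseteq> insert 0 (range \<sigma>)" "I = {i\<in>{..<m}. \<sigma> i \<in> S}"
    using left_singular_subspace_col_span_iff[OF svd A I] by blast
  then have "left_singular_subspace A (col_span U ({..<m} - I))"
    by (subst left_singular_subspace_col_span_iff[OF svd A])
      (auto intro!: exI[of _ "insert 0 (range \<sigma>) - S"])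
  then show "A \<in> left_dom m n ({..<m} - I)"
    using A svd by (auto simp: left_dom_def)
qed

lemma left_dom_complement:
  assumes I: "I \<subseteq> {..<m}"
  shows "(left_dom m n ({..<m} - I) :: 'a::real_or_complex_field mat set) = left_dom m n I"
proof
  have "{..<m} - ({..<m} - I) = I" using I by auto
  then show "(left_dom m n ({..<m} - I) :: 'a mat set) \<subseteq> left_dom m n I"
    using left_dom_complement_subset[of "{..<m} - I" m n, where 'a = 'a] by auto
qed (rule left_dom_complement_subset[OF I])

section \<open>Nonzero eigenvalues of a product and of the swapped product\<close>

lemma char_poly_block_lower_triangular:
  fixes A :: "'a::idom mat"
  assumes A: "A \<in> carrier_mat n n" and C: "C \<in> carrier_mat m n" and D: "D \<in> carrier_mat m m"
  shows "char_poly (four_block_mat A (0\<^sub>m n m) C D) = char_poly A * char_poly D"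
proof -
  have "char_poly_matrix (four_block_mat A (0\<^sub>m n m) C D) =
      four_block_mat (char_poly_matrix A) (0\<^sub>m n m) (map_mat (\<lambda>a. [:- a:]) C) (char_poly_matrix D)"
    using assms by (intro eq_matI) (auto simp: char_poly_matrix_def)
  then show ?thesis
    unfolding char_poly_def using assms
    by (subst det_four_block_mat_upper_right_zero[of _ n _ m, symmetric]) auto
qed

lemma char_poly_zero_mat: "char_poly (0\<^sub>m n n :: 'a::field mat) = [:0, 1:] ^ n"
proof -
  have "0\<^sub>m n n = rect_diag n n (\<lambda>_. 0 :: 'a)" by (rule eq_matI) (auto simp: rect_diag_def)
  then show ?thesis by (simp only: char_poly_rect_diag) simp
qed

text \<open>
  The products \<open>N M\<close> and \<open>M N\<close> have the same nonzero eigenvalues with the same multiplicities. The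
  block matrices with rows \<open>(N M, 0)\<close>, \<open>(M, 0)\<close> and \<open>(0, 0)\<close>, \<open>(M, M N)\<close> are similar through the block
  matrix with rows \<open>(1, N)\<close>, \<open>(0, 1)\<close>; the two powers come from their zero diagonal blocks.
\<close>

lemma char_poly_mult_swap:
  fixes N :: "'a::field mat"
  assumes N: "N \<in> carrier_mat d e" and M: "M \<in> carrier_mat e d"
  shows "char_poly (N * M) * [:0, 1:] ^ e = char_poly (M * N) * [:0, 1:] ^ d"
proof -
  define K where "K = four_block_mat (N * M) (0\<^sub>m d e) M (0\<^sub>m e e)"
  define L where "L = four_block_mat (0\<^sub>m d d) (0\<^sub>m d e) M (M * N)"
  define P where "P = four_block_mat (1\<^sub>m d) N (0\<^sub>m e d) (1\<^sub>m e)"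
  define Q where "Q = four_block_mat (1\<^sub>m d) (- N) (0\<^sub>m e d) (1\<^sub>m e)"
  have car: "K \<in> carrier_mat (d + e) (d + e)" "L \<in> carrier_mat (d + e) (d + e)"
    "P \<in> carrier_mat (d + e) (d + e)" "Q \<in> carrier_mat (d + e) (d + e)"
    using N M by (auto simp: K_def L_def P_def Q_def)
  have NM: "N * M \<in> carrier_mat d d" "M * N \<in> carrier_mat e e" "N * M * N \<in> carrier_mat d e"
    using N M by auto
  have "- 0\<^sub>m e e + 1\<^sub>m e = (1\<^sub>m e :: 'a mat)" by (intro eq_matI) auto
  then have PQ: "P * Q = 1\<^sub>m (d + e)"
    unfolding P_def Q_def using N
    by (subst mult_four_block_mat[of _ d d _ e _ e _ _ d _ e]) auto
  then have QP: "Q * P = 1\<^sub>m (d + e)" using mat_mult_left_right_inverse[OF car(3,4)] by simp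
  have "K * P = four_block_mat (N * M) (N * M * N) M (M * N)"
    unfolding K_def P_def using N M NM
    by (subst mult_four_block_mat[of _ d d _ e _ e _ _ d _ e]) auto
  moreover have "P * L = four_block_mat (N * M) (N * M * N) M (M * N)"
    unfolding L_def P_def using N M NM
    by (subst mult_four_block_mat[of _ d d _ e _ e _ _ d _ e]) auto
  ultimately have KP: "K * P = P * L" by simp
  have "K = K * (P * Q)" using PQ car by simp
  also have "\<dots> = P * L * Q" unfolding assoc_mult_mat[OF car(1,3,4), symmetric] KP ..
  finally have "similar_mat K L"
    using car PQ QP by (intro similar_matI[of _ _ P Q "d + e"]) auto
  then have "char_poly K = char_poly L" by (rule char_poly_similar)
  then show ?thesis
    using N M NM by (simp add: K_def L_def char_poly_block_lower_triangular char_poly_zero_mat mult.commute)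
qed

section \<open>Principal angles of complementary subspaces\<close>

lemma orthonormal_basis_mat_exists:
  fixes U :: "'a::real_or_complex_field mat"
  assumes U: "unitary_mat m U" and I: "I \<subseteq> {..<m}"
  shows "\<exists>Q. orthonormal_basis_mat m (card I) (col_span U I) Q"
proof -
  note c = unitary_matD[OF U]
  define d where "d = card I"
  obtain e where e: "bij_betw e {..<d} I"
    using ex_bij_betw_nat_finite[of I] finite_subset[OF I] by (auto simp: lessThan_atLeast0 d_def)
  have eI: "e i < m" if "i < d" for i using e that I by (auto simp: bij_betw_def)
  define Q where "Q = mat m d (\<lambda>(k, i). U $$ (k, e i))"
  have Q: "Q \<in> carrier_mat m d" by (simp add: Q_def)
  have colQ: "col Q i = col U (e i)" if "i < d" for i
    using that eI c(1) by (intro eq_vecI) (auto simp: Q_def)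
  have "mat_adjoint Q * Q = 1\<^sub>m d"
  proof (rule eq_matI)
    fix i j assume "i < dim_row (1\<^sub>m d)" "j < dim_col (1\<^sub>m d)"
    then have ij: "i < d" "j < d" by auto
    then have "e i = e j \<longleftrightarrow> i = j" using e by (auto simp: bij_betw_def inj_on_def)
    then show "(mat_adjoint Q * Q) $$ (i, j) = 1\<^sub>m d $$ (i, j)"
      using ij by (simp add: index_adjoint_mult[OF Q Q] colQ unitary_cols[OF U] eI del: index_mult_mat)
  qed (use Q in auto)
  moreover have "col Q ` {..<d} = col U ` I"
    using e colQ by (force simp: bij_betw_def)
  then have "col_span Q {..<d} = col_span U I"
    using Q c(1) by (simp add: col_span_def)
  ultimately show ?thesis using Q by (auto simp: orthonormal_basis_mat_def d_def)
qed

lemma orthonormal_basis_mat_col: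
  fixes Q :: "'a::conjugatable_field mat"
  assumes Q: "orthonormal_basis_mat m d W Q" and i: "i < d"
  shows "col Q i \<in> W"
proof -
  interpret vec_space "TYPE('a)" m .
  have "Q \<in> carrier_mat m d" "W = span (col Q ` {..<d})"
    using Q by (auto simp: orthonormal_basis_mat_def col_span_def)
  then show ?thesis using i by (auto intro!: in_own_span[THEN subsetD])
qed

lemma adjoint_mult_eq_zero:
  fixes Q :: "'a::conjugatable_field mat"
  assumes U: "unitary_mat m U" and I: "I \<subseteq> {..<m}"
    and Q: "orthonormal_basis_mat m d (col_span U I) Q"
    and R: "orthonormal_basis_mat m e (col_span U ({..<m} - I)) R"
  shows "mat_adjoint Q * R = 0\<^sub>m d e"
proof (rule eq_matI)
  have c: "Q \<in> carrier_mat m d" "R \<in> carrier_mat m e"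
    using Q R by (auto simp: orthonormal_basis_mat_def)
  fix i j assume "i < dim_row (0\<^sub>m d e)" "j < dim_col (0\<^sub>m d e)"
  then have ij: "i < d" "j < e" by auto
  have "col Q i \<bullet>c col R j = 0"
    using col_span_orthogonal[OF U I orthonormal_basis_mat_col[OF Q] orthonormal_basis_mat_col[OF R]] ij
    by simp
  then have "col R j \<bullet>c col Q i = 0"
    using c by (metis conjugate_conjugate_sprod conjugate_vec_sprod_comm conjugate_zero col_dim carrier_matD(1))
  then show "(mat_adjoint Q * R) $$ (i, j) = 0\<^sub>m d e $$ (i, j)"
    using ij by (simp add: index_adjoint_mult[OF c] del: index_mult_mat)
qed (use Q R in \<open>auto simp: orthonormal_basis_mat_def\<close>)

lemma sum_lessThan_add:
  "(\<Sum>k<d + e. f k) = (\<Sum>k<d. f k) + (\<Sum>k<e. f (d + k))" for f :: "nat \<Rightarrow> 'a::comm_monoid_add"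
  by (induction e) (auto simp: add_ac)

text \<open>
  Side by side, the two bases form a square matrix \<open>X\<close> with \<open>X\<^sup>H X = 1\<close>; then \<open>X X\<^sup>H = 1\<close> as well,
  and \<open>X X\<^sup>H\<close> is the sum of the two projectors.
\<close>

lemma projectors_add_to_one:
  fixes Q :: "'a::real_or_complex_field mat"
  assumes U: "unitary_mat m U" and I: "I \<subseteq> {..<m}"
    and Q: "orthonormal_basis_mat m (card I) (col_span U I) Q"
    and R: "orthonormal_basis_mat m (card ({..<m} - I)) (col_span U ({..<m} - I)) R"
  shows "Q * mat_adjoint Q + R * mat_adjoint R = 1\<^sub>m m"
proof -
  define d e where "d = card I" and "e = card ({..<m} - I)"
  have de: "d + e = m"
    using I card_mono[OF _ I] finite_subset[OF I] by (simp add: d_def e_def card_Diff_subset)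
  have c: "Q \<in> carrier_mat m d" "R \<in> carrier_mat m e"
    and QQ: "mat_adjoint Q * Q = 1\<^sub>m d" and RR: "mat_adjoint R * R = 1\<^sub>m e"
    using Q R by (auto simp: orthonormal_basis_mat_def d_def e_def)
  have QR: "mat_adjoint Q * R = 0\<^sub>m d e"
    using adjoint_mult_eq_zero[OF U I Q R] by (simp add: d_def e_def)
  have "mat_adjoint (mat_adjoint Q * R) = 0\<^sub>m e d" unfolding QR by (rule eq_matI) auto
  then have RQ: "mat_adjoint R * Q = 0\<^sub>m e d"
    using c by (simp add: mat_adjoint_mult[of _ d m _ e])
  define X where "X = mat m m (\<lambda>(k, i). if i < d then Q $$ (k, i) else R $$ (k, i - d))"
  have X: "X \<in> carrier_mat m m" by (simp add: X_def)
  have colX: "col X i = (if i < d then col Q i else col R (i - d))" if "i < m" for i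
    using that c de by (intro eq_vecI) (auto simp: X_def)
  have ip: "col Q j \<bullet>c col Q i = (if i = j then 1 else 0)" if "i < d" "j < d" for i j
    using index_adjoint_mult[OF c(1) c(1) that] that by (simp add: QQ)
  have ip2: "col R j \<bullet>c col R i = (if i = j then 1 else 0)" if "i < e" "j < e" for i j
    using index_adjoint_mult[OF c(2) c(2) that] that by (simp add: RR)
  have ip3: "col R j \<bullet>c col Q i = 0" if "i < d" "j < e" for i j
    using index_adjoint_mult[OF c that] that by (simp add: QR)
  have ip4: "col Q j \<bullet>c col R i = 0" if "i < e" "j < d" for i j
    using index_adjoint_mult[OF c(2,1) that] that by (simp add: RQ)
  have "mat_adjoint X * X = 1\<^sub>m m"
  proof (rule eq_matI)
    fix i j assume "i < dim_row (1\<^sub>m m)" "j < dim_col (1\<^sub>m m)"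
    then have ij: "i < m" "j < m" by auto
    show "(mat_adjoint X * X) $$ (i, j) = 1\<^sub>m m $$ (i, j)"
      unfolding index_adjoint_mult[OF X X ij] colX[OF ij(1)] colX[OF ij(2)]
      using ij de by (auto simp: ip ip2 ip3 ip4)
  qed (use X in auto)
  then have XX: "X * mat_adjoint X = 1\<^sub>m m"
    using unitary_matI[OF X] unitary_matD(3) by blast
  show ?thesis
  proof (rule eq_matI)
    fix i j assume "i < dim_row (1\<^sub>m m)" "j < dim_col (1\<^sub>m m)"
    then have ij: "i < m" "j < m" by auto
    have "(X * mat_adjoint X) $$ (i, j) = (\<Sum>k<d + e. X $$ (i, k) * conjugate (X $$ (j, k)))"
      using ij X de by (auto simp: scalar_prod_def lessThan_atLeast0 intro!: sum.cong)
    also have "\<dots> = (\<Sum>k<d. Q $$ (i, k) * conjugate (Q $$ (j, k))) + (\<Sum>k<e. R $$ (i, k) * conjugate (R $$ (j, k)))"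
      unfolding sum_lessThan_add using ij de by (intro arg_cong2[of _ _ _ _ "(+)"] sum.cong) (auto simp: X_def)
    also have "\<dots> = (Q * mat_adjoint Q + R * mat_adjoint R) $$ (i, j)"
      using ij c by (auto simp: scalar_prod_def lessThan_atLeast0 intro!: arg_cong2[of _ _ _ _ "(+)"] sum.cong)
    finally show "(Q * mat_adjoint Q + R * mat_adjoint R) $$ (i, j) = 1\<^sub>m m $$ (i, j)"
      using XX by simp
  qed (use c in auto)
qed

text \<open>
  This is \<open>Q\<^sup>H (X X\<^sup>H + Y Y\<^sup>H) Q = Q\<^sup>H Q\<close>. With \<open>Y\<close> a basis of a subspace and \<open>X\<close> one of its complement
  it is the matrix form of \<open>sin\<^sup>2 = 1 - cos\<^sup>2\<close>.
\<close>

lemma gram_add_gram: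
  fixes Q :: "'a::real_or_complex_field mat"
  assumes Q: "Q \<in> carrier_mat m d" "mat_adjoint Q * Q = 1\<^sub>m d"
    and X: "X \<in> carrier_mat m a" and Y: "Y \<in> carrier_mat m b"
    and XY: "X * mat_adjoint X + Y * mat_adjoint Y = 1\<^sub>m m"
  shows "(mat_adjoint Q * X) * mat_adjoint (mat_adjoint Q * X) =
    1\<^sub>m d - (mat_adjoint Q * Y) * mat_adjoint (mat_adjoint Q * Y)"
proof -
  have Qh: "mat_adjoint Q \<in> carrier_mat d m" using Q by auto
  have eq: "(mat_adjoint Q * Z) * mat_adjoint (mat_adjoint Q * Z) = mat_adjoint Q * (Z * mat_adjoint Z) * Q"
    if "Z \<in> carrier_mat m k" for Z k
    using that Q by (simp add: mat_adjoint_mult[OF Qh that] mult_mat_assoc_dim)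
  have XX: "X * mat_adjoint X \<in> carrier_mat m m" and YY: "Y * mat_adjoint Y \<in> carrier_mat m m"
    using X Y by auto
  have "mat_adjoint Q * (X * mat_adjoint X) * Q + mat_adjoint Q * (Y * mat_adjoint Y) * Q =
      mat_adjoint Q * (X * mat_adjoint X + Y * mat_adjoint Y) * Q"
    using mult_add_distrib_mat[OF Qh XX YY]
      add_mult_distrib_mat[OF mult_carrier_mat[OF Qh XX] mult_carrier_mat[OF Qh YY] Q(1)]
    by simp
  also have "\<dots> = 1\<^sub>m d" using XY Q Qh by simp
  finally have *: "mat_adjoint Q * (X * mat_adjoint X) * Q + mat_adjoint Q * (Y * mat_adjoint Y) * Q = 1\<^sub>m d" .
  have c: "mat_adjoint Q * (X * mat_adjoint X) * Q \<in> carrier_mat d d"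
    "mat_adjoint Q * (Y * mat_adjoint Y) * Q \<in> carrier_mat d d"
    using Q Qh X Y by auto
  show ?thesis
    unfolding eq[OF X] eq[OF Y] *[symmetric] using c by (intro eq_matI) auto
qed

text \<open>
  The heart of the matter: up to padding by zeros, a pair of subspaces and the pair of their
  complements have the same squared sines \<open>1 - \<sigma>\<^sub>i\<^sup>2\<close>. Let \<open>N = Q\<^sup>H R'\<close>. The squared sines of the first
  pair are the eigenvalues of \<open>N N\<^sup>H\<close>, those of the second pair the eigenvalues of \<open>N\<^sup>H N\<close>, and these
  agree apart from zeros.
\<close>

lemma complementary_squared_sines:
  fixes U U' :: "'a::real_or_complex_field mat"
  assumes U: "unitary_mat m U" and U': "unitary_mat m U'" and I: "I \<subseteq> {..<m}"
    and Q: "orthonormal_basis_mat m (card I) (col_span U I) Q"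
    and R: "orthonormal_basis_mat m (card ({..<m} - I)) (col_span U ({..<m} - I)) R"
    and Q': "orthonormal_basis_mat m (card I) (col_span U' I) Q'"
    and R': "orthonormal_basis_mat m (card ({..<m} - I)) (col_span U' ({..<m} - I)) R'"
  shows "image_mset (\<lambda>i. 1 - (sing_val (mat_adjoint Q * Q') i)\<^sup>2) (mset_set {..<card I}) +
      replicate_mset (card ({..<m} - I)) 0 =
    image_mset (\<lambda>i. 1 - (sing_val (mat_adjoint R * R') i)\<^sup>2) (mset_set {..<card ({..<m} - I)}) +
      replicate_mset (card I) 0"
proof -
  define d e where "d = card I" and "e = card ({..<m} - I)"
  have c: "Q \<in> carrier_mat m d" "R \<in> carrier_mat m e" "Q' \<in> carrier_mat m d" "R' \<in> carrier_mat m e"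
    and one: "mat_adjoint Q * Q = 1\<^sub>m d" "mat_adjoint R' * R' = 1\<^sub>m e"
    using Q R Q' R' by (auto simp: orthonormal_basis_mat_def d_def e_def)
  note ch = c[THEN mat_adjoint_carrier]
  define N where "N = mat_adjoint Q * R'"
  have N: "N \<in> carrier_mat d e" "mat_adjoint N \<in> carrier_mat e d" using c ch by (auto simp: N_def)
  have MQ: "mat_adjoint Q * Q' \<in> carrier_mat d d" and MR: "mat_adjoint R * R' \<in> carrier_mat e e"
    using c ch by auto
  obtain X \<sigma> Y where svdQ: "full_svd (mat_adjoint Q * Q') X \<sigma> Y"
    using square_full_svd_exists[OF MQ] by blast
  obtain X' \<tau> Y' where svdR: "full_svd (mat_adjoint R * R') X' \<tau> Y'"
    using square_full_svd_exists[OF MR] by blast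
  \<comment> \<open>\<open>N\<^sup>H N\<close> involves the adjoint of the second cosine matrix, which has the same singular values\<close>
  have svdR': "full_svd (mat_adjoint R' * R) Y' \<tau> X'"
    using full_svd_adjoint[OF svdR] by (simp add: mat_adjoint_mult[OF ch(2) c(4)])
  have MR': "mat_adjoint R' * R \<in> carrier_mat e e" using c ch by auto
  have "R' * mat_adjoint R' + Q' * mat_adjoint Q' = 1\<^sub>m m"
    using projectors_add_to_one[OF U' I Q' R'] c ch by (simp add: comm_add_mat[of _ m m])
  then have "N * mat_adjoint N =
      1\<^sub>m d - (mat_adjoint Q * Q') * mat_adjoint (mat_adjoint Q * Q')"
    unfolding N_def by (rule gram_add_gram[OF c(1) one(1) c(4) c(3)])
  then have cpQ: "char_poly (N * mat_adjoint N) = (\<Prod>i<d. [:- of_real (1 - (\<sigma> i)\<^sup>2), 1:])"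
    using char_poly_one_minus_gram[OF svdQ MQ] by simp
  have Nh: "mat_adjoint N = mat_adjoint R' * Q" by (simp add: N_def mat_adjoint_mult[OF ch(1) c(4)])
  have "mat_adjoint N * mat_adjoint (mat_adjoint N) =
      1\<^sub>m e - (mat_adjoint R' * R) * mat_adjoint (mat_adjoint R' * R)"
    unfolding Nh by (rule gram_add_gram[OF c(4) one(2) c(1) c(2) projectors_add_to_one[OF U I Q R]])
  then have cpR: "char_poly (mat_adjoint N * N) = (\<Prod>i<e. [:- of_real (1 - (\<tau> i)\<^sup>2), 1:])"
    using char_poly_one_minus_gram[OF svdR' MR'] by simp
  have roots: "proots ((\<Prod>i<k. [:- of_real (f i), 1:]) * [:0, 1:] ^ l :: 'a poly) =
      image_mset of_real (image_mset f (mset_set {..<k}) + replicate_mset l 0)"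
    for k l and f :: "nat \<Rightarrow> real"
  proof -
    have "(\<Prod>i<k. [:- of_real (f i), 1:] :: 'a poly) \<noteq> 0" by simp
    then have "proots ((\<Prod>i<k. [:- of_real (f i), 1:]) * [:0, 1:] ^ l :: 'a poly) =
        proots (\<Prod>i<k. [:- of_real (f i), 1:] :: 'a poly) + repeat_mset l {#0#}"
      by (subst proots_mult) (auto simp: proots_power proots_linear_factor[of 0, simplified])
    then show ?thesis
      by (simp add: proots_prod_linear multiset.map_comp comp_def)
  qed
  have "(\<Prod>i<d. [:- of_real (1 - (\<sigma> i)\<^sup>2), 1:]) * [:0, 1:] ^ e =
      (\<Prod>i<e. [:- of_real (1 - (\<tau> i)\<^sup>2), 1:] :: 'a poly) * [:0, 1:] ^ d"
    using char_poly_mult_swap[OF N] by (simp only: cpQ cpR)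
  then have "image_mset (of_real :: real \<Rightarrow> 'a) (image_mset (\<lambda>i. 1 - (\<sigma> i)\<^sup>2) (mset_set {..<d}) + replicate_mset e 0) =
      image_mset of_real (image_mset (\<lambda>i. 1 - (\<tau> i)\<^sup>2) (mset_set {..<e}) + replicate_mset d 0)"
    unfolding roots[symmetric] by simp
  then have "image_mset (\<lambda>i. 1 - (\<sigma> i)\<^sup>2) (mset_set {..<d}) + replicate_mset e 0 =
      image_mset (\<lambda>i. 1 - (\<tau> i)\<^sup>2) (mset_set {..<e}) + replicate_mset d 0"
    by (rule multiset.inj_map[OF inj_of_real, THEN injD])
  then show ?thesis
    by (simp add: sing_val_eqI[OF svdQ] sing_val_eqI[OF svdR] d_def e_def)
qed

text \<open>
  The square of each of the three distances is the sum of a function \<open>g\<close> of the squared sines with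
  \<open>g 0 = 0\<close>, so padding the multiset of squared sines by zeros does not change it.
\<close>

lemma gr_dist_complement:
  fixes U U' :: "'a::real_or_complex_field mat"
  assumes U: "unitary_mat m U" and U': "unitary_mat m U'" and I: "I \<subseteq> {..<m}"
  shows "gr_dist \<delta> m (card I) (col_span U I) (col_span U' I) =
    gr_dist \<delta> m (card ({..<m} - I)) (col_span U ({..<m} - I)) (col_span U' ({..<m} - I))"
proof -
  define B where "B d W = (SOME Q :: 'a mat. orthonormal_basis_mat m d W Q)" for d W
  have B: "orthonormal_basis_mat m (card J) (col_span W J) (B (card J) (col_span W J))"
    if "unitary_mat m W" "J \<subseteq> {..<m}" for W J
    unfolding B_def using orthonormal_basis_mat_exists[OF that] by (rule someI_ex)
  \<comment> \<open>the squared contribution of an angle to the distance, as a function of its squared sine \<open>t\<close>; \<open>arccos 1 = 0\<close> gives \<open>g 0 = 0\<close>\<close>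
  define g where "g t = (angle_fun \<delta> (arccos (sqrt (1 - t))))\<^sup>2" for t
  have g0: "g 0 = 0" by (cases \<delta>) (simp_all add: g_def)
  have dist: "gr_dist \<delta> m (card J) (col_span U J) (col_span U' J) =
      sqrt (\<Sum>t\<in>#image_mset (\<lambda>i. 1 - (sing_val (mat_adjoint (B (card J) (col_span U J)) *
        B (card J) (col_span U' J)) i)\<^sup>2) (mset_set {..<card J}) + replicate_mset k 0. g t)"
    if J: "J \<subseteq> {..<m}" for J k
  proof -
    define M where "M = mat_adjoint (B (card J) (col_span U J)) * B (card J) (col_span U' J)"
    have M: "M \<in> carrier_mat (card J) (card J)"
      using B[OF U J] B[OF U' J] by (auto simp: M_def orthonormal_basis_mat_def)
    obtain X \<sigma> Y where svd: "full_svd M X \<sigma> Y" using square_full_svd_exists[OF M] by blast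
    have "0 \<le> sing_val M i" for i
      using full_svdD(7)[OF svd M] by (simp add: sing_val_eqI[OF svd])
    then have "g (1 - (sing_val M i)\<^sup>2) = (angle_fun \<delta> (arccos (sing_val M i)))\<^sup>2" for i
      by (simp add: g_def)
    then show ?thesis
      by (simp add: gr_dist_def principal_angle_def B_def[symmetric] M_def[symmetric]
          multiset.map_comp comp_def g0 sum_unfold_sum_mset)
  qed
  show ?thesis
    unfolding dist[OF I, of "card ({..<m} - I)"] dist[OF Diff_subset, of I "card I"]
    using complementary_squared_sines[OF U U' I B[OF U I] B[OF U Diff_subset] B[OF U' I] B[OF U' Diff_subset]]
    by simp
qed

section \<open>Condition numbers\<close>

text \<open>
  The two maps have the same domain and, on it, distances of values that agree exactly. So already
  the suprema at each fixed \<open>\<epsilon>\<close> coincide, and no limit has to be computed.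
\<close>

lemma left_cond_complement:
  fixes A :: "'a::real_or_complex_field mat"
  assumes I: "I \<subseteq> {..<m}" and A: "A \<in> left_dom m n I"
  shows "left_cond \<delta> m n I A = left_cond \<delta> m n ({..<m} - I) A"
proof -
  have dist: "gr_dist \<delta> m (card I) (left_map I A) (left_map I A') =
      gr_dist \<delta> m (card ({..<m} - I)) (left_map ({..<m} - I) A) (left_map ({..<m} - I) A')"
    if A': "A' \<in> left_dom m n I" for A'
  proof -
    obtain U \<sigma> V where svd: "A \<in> carrier_mat m n" "full_svd A U \<sigma> V"
      using A by (auto simp: left_dom_def)
    obtain U' \<sigma>' V' where svd': "A' \<in> carrier_mat m n" "full_svd A' U' \<sigma>' V'"
      using A' by (auto simp: left_dom_def)
    have "A \<in> left_dom m n ({..<m} - I)" "A' \<in> left_dom m n ({..<m} - I)"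
      using A A' by (simp_all add: left_dom_complement[OF I])
    then show ?thesis
      using gr_dist_complement[OF full_svdD(1)[OF svd(2,1)] full_svdD(1)[OF svd'(2,1)] I]
      by (simp add: left_map_eq[OF A I svd(2)] left_map_eq[OF A' I svd'(2)]
          left_map_eq[OF _ Diff_subset svd(2)] left_map_eq[OF _ Diff_subset svd'(2)])
  qed
  have "(SUP x'\<in>{x' \<in> left_dom m n I. 0 < frob_dist A x' \<and> frob_dist A x' \<le> \<epsilon>}.
      ennreal (gr_dist \<delta> m (card I) (left_map I A) (left_map I x') / frob_dist A x')) =
    (SUP x'\<in>{x' \<in> left_dom m n ({..<m} - I). 0 < frob_dist A x' \<and> frob_dist A x' \<le> \<epsilon>}.
      ennreal (gr_dist \<delta> m (card ({..<m} - I)) (left_map ({..<m} - I) A) (left_map ({..<m} - I) x')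
        / frob_dist A x'))" for \<epsilon>
    by (rule SUP_cong) (simp_all add: left_dom_complement[OF I] dist)
  then show ?thesis
    by (simp add: left_cond_def cond_number_def)
qed

lemma left_singular_complement:
  fixes A :: "'a::real_or_complex_field mat"
  assumes I: "I \<subseteq> {..<m}" and A: "A \<in> left_dom m n I"
  shows "A \<in> left_dom m n ({..<m} - I) \<and>
    left_map ({..<m} - I) A = orth_compl m (left_map I A) \<and>
    left_cond \<delta> m n I A = left_cond \<delta> m n ({..<m} - I) A"
proof (intro conjI)
  show A': "A \<in> left_dom m n ({..<m} - I)" using A by (simp add: left_dom_complement[OF I])
  obtain U \<sigma> V where svd: "A \<in> carrier_mat m n" "full_svd A U \<sigma> V"
    using A by (auto simp: left_dom_def)
  show "left_map ({..<m} - I) A = orth_compl m (left_map I A)"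
    by (simp add: left_map_eq[OF A I svd(2)] left_map_eq[OF A' Diff_subset svd(2)]
        orth_compl_col_span[OF full_svdD(1)[OF svd(2,1)] I])
qed (rule left_cond_complement[OF assms])

theorem lemma2:
  fixes m n :: nat and \<pi> :: "nat set" and \<delta> :: gr_metric
  assumes "\<pi> \<subseteq> {..<m}"
  shows "(\<forall>A \<in> (left_dom m n \<pi> :: real mat set).
            A \<in> left_dom m n ({..<m} - \<pi>) \<and>
            left_map ({..<m} - \<pi>) A = orth_compl m (left_map \<pi> A) \<and>
            left_cond \<delta> m n \<pi> A = left_cond \<delta> m n ({..<m} - \<pi>) A) \<and>
         (\<forall>A \<in> (left_dom m n \<pi> :: complex mat set).
            A \<in> left_dom m n ({..<m} - \<pi>) \<and>
            left_map ({..<m} - \<pi>) A = orth_compl m (left_map \<pi> A) \<and>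
            left_cond \<delta> m n \<pi> A = left_cond \<delta> m n ({..<m} - \<pi>) A)"
  using left_singular_complement[OF assms, where 'a = real]
    left_singular_complement[OF assms, where 'a = complex] by blast

end
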